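(* Let $\lambda>0$. The average speed of the benchmark mean-field limit (BMFL) is $v_{**}$.
   Context: Let $\lambda>0$ and let $Z>0$ be a random variable with CDF $J$ and $\mathbb{E}Z=1$. $\mathcal{M}$ is the set of (proper) cumulative distribution functions on $\mathbb{R}$. BMFL. Consider $n$ particles on $\mathbb{R}$: each jumps forward by i.i.d. copies of $Z$ at the points of its own independent Poisson process of rate $\lambda$, and at the points of another independent Poisson process of rate $1$ chooses another particle uniformly at random and moves to its location if that is to the right. The mean-field limit (MFL) with initial state $f(0)\in\mathcal{M}$ is the deterministic $n\to\infty$ limit of the empirical distribution functions of particle locations when the initial ones converge weakly to $f(0)$; it coincides with the unique function $f_x(t)$ with that initial state such that (a) $f(t)\in\mathcal{M}$ for all $t$; (b) for every $x$, $f_x(t)$ is non-increasing and $(\lambda+1)$-Lipschitz in $t$; (c) for every $x$ and every $t$ at which the derivative exists, $$\frac{\partial}{\partial t}f_x(t)=-\lambda\int_{(-\infty,x]}(1-J(x-y))\,d_yf_y(t)-f_x(t)(1-f_x(t)).$$ The BMFL is the MFL with $f_x(0)=\mathbf{1}\{x\ge0\}$. Average speed. For $f\in\mathcal{M}$, $q_\nu(f)=\inf\{y:f_y\ge\nu\}$. The average speed of an MFL $f(\cdot)$ is lower bounded by $v$ if for every $\nu\in(0,1)$, $\liminf_{t\to\infty}\frac1t[q_\nu(f(t))-q_\nu(f(0))]\ge v$; it is upper bounded by $v$ if for every $\nu\in(0,1)$, $\limsup_{t\to\infty}\frac1t[q_\nu(f(t))-q_\nu(f(0))]\le v$. The average speed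 is $v$ if $v$ is both a lower and an upper bound. Critical speed $v_{**}$. Let $L(s)=\int_0^\infty e^{-sx}\,dJ(x)$ and $\alpha=\sup\{\zeta\ge0:L(-\zeta)<\infty\}\in[0,\infty]$. If $\alpha>0$, let $$v(\zeta)=\frac1\zeta\,[\lambda L(-\zeta)-\lambda+1],\quad\zeta>0\quad(v(\zeta)=+\infty\text{ if }L(-\zeta)=\infty),\qquad v_{**}=\min_{\zeta>0}v(\zeta),$$ the minimum being attained at a unique point $\zeta_{**}\in(0,\alpha]$ with $\zeta_{**}<\infty$. If $\alpha=0$, by convention $v_{**}=+\infty$. *)

theory Defs
  imports "HOL-Probability.Probability"
begin

definition proper_cdfs :: "(real \<Rightarrow> real) set" where
  "proper_cdfs = {cdf M | M. real_distribution M}"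

(* The mean-field limit is characterized by its evolution equation, whose solution is unique
   for t >= 0 given the initial state.  f t x stands for f_x(t); only times t >= 0 matter,
   so at t = 0 the derivative is the one-sided one.  The measure d_y f_y(t) is the
   Lebesgue--Stieltjes measure of f t. *)
definition is_mfl :: "real \<Rightarrow> (real \<Rightarrow> real) \<Rightarrow> (real \<Rightarrow> real \<Rightarrow> real) \<Rightarrow> bool" where
  "is_mfl lam J f \<longleftrightarrow>
     (\<forall>t\<ge>0. f t \<in> proper_cdfs) \<and>
     (\<forall>x. antimono_on {0..} (\<lambda>t. f t x) \<and> (lam + 1)-lipschitz_on {0..} (\<lambda>t. f t x)) \<and>
     (\<forall>x. \<forall>t\<ge>0. (\<lambda>s. f s x) differentiable (at t within {0..}) \<longrightarrow>
        ((\<lambda>s. f s x) has_real_derivative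
           - lam * (LINT y:{..x}|interval_measure (f t). 1 - J (x - y)) - f t x * (1 - f t x))
          (at t within {0..}))"

definition is_bmfl :: "real \<Rightarrow> (real \<Rightarrow> real) \<Rightarrow> (real \<Rightarrow> real \<Rightarrow> real) \<Rightarrow> bool" where
  "is_bmfl lam J f \<longleftrightarrow> is_mfl lam J f \<and> f 0 = indicator {0..}"

definition quantile :: "real \<Rightarrow> (real \<Rightarrow> real) \<Rightarrow> real" where
  "quantile \<nu> F = Inf {y. F y \<ge> \<nu>}"

definition speed_lower_bound :: "(real \<Rightarrow> real \<Rightarrow> real) \<Rightarrow> ereal \<Rightarrow> bool" where
  "speed_lower_bound f v \<longleftrightarrow>
     (\<forall>\<nu>\<in>{0<..<1}.
        Liminf at_top (\<lambda>t. ereal (1 / t * (quantile \<nu> (f t) - quantile \<nu> (f 0)))) \<ge> v)"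

definition speed_upper_bound :: "(real \<Rightarrow> real \<Rightarrow> real) \<Rightarrow> ereal \<Rightarrow> bool" where
  "speed_upper_bound f v \<longleftrightarrow>
     (\<forall>\<nu>\<in>{0<..<1}.
        Limsup at_top (\<lambda>t. ereal (1 / t * (quantile \<nu> (f t) - quantile \<nu> (f 0)))) \<le> v)"

definition has_average_speed :: "(real \<Rightarrow> real \<Rightarrow> real) \<Rightarrow> ereal \<Rightarrow> bool" where
  "has_average_speed f v \<longleftrightarrow> speed_lower_bound f v \<and> speed_upper_bound f v"

definition laplace_transform :: "(real \<Rightarrow> real) \<Rightarrow> real \<Rightarrow> ennreal" where
  "laplace_transform J s = (\<integral>\<^sup>+x\<in>{0..}. ennreal (exp (- s * x)) \<partial>interval_measure J)"

definition exp_abscissa :: "(real \<Rightarrow> real) \<Rightarrow> ereal" where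
  "exp_abscissa J = Sup {ereal \<zeta> | \<zeta>. \<zeta> \<ge> 0 \<and> laplace_transform J (- \<zeta>) < \<infinity>}"

(* For lam > 0 and \<zeta> > 0, extended-real arithmetic gives the value \<infinity> exactly when
   laplace_transform J (- \<zeta>) = \<infinity>. *)
definition speed_function :: "real \<Rightarrow> (real \<Rightarrow> real) \<Rightarrow> real \<Rightarrow> ereal" where
  "speed_function lam J \<zeta> =
     ereal (1 / \<zeta>) *
       (ereal lam * enn2ereal (laplace_transform J (- \<zeta>)) - ereal lam + 1)"

(* LEAST is a genuine minimum: in the first case it is attained whenever J is the cdf of a
   positive random variable with mean 1. *)
definition critical_speed :: "real \<Rightarrow> (real \<Rightarrow> real) \<Rightarrow> ereal" where
  "critical_speed lam J =
     (if exp_abscissa J > 0 then LEAST w. w \<in> speed_function lam J ` {0<..} else \<infinity>)"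

end

theory Submission imports Defs begin

text \<open>Let \<open>u t x = 1 - f t x\<close> be the fraction of mass to the right of \<open>x\<close>.  Since \<open>Z\<close> is positive, the integral
in the evolution equation is \<open>F x - E F (x - Z)\<close>, so \<open>u\<close> solves an equation of
Fisher-KPP type in which the diffusion is replaced by jumps to the right:
\<open>u' = lam * (E u (x - Z) - u) + u * (1 - u)\<close>.
The linearised equation has the solutions \<open>exp (- \<zeta> * (x - v \<zeta> * t))\<close>, where \<open>v\<close> is the speed function, and the
theorem says that the front is pulled: it moves at the smallest of these speeds.

The evolution equation is given only at times where the derivative exists, so the first step is Lebesgue's
differentiation theorem for monotone Lipschitz functions (\<open>lipschitz_mono_differentiable_ae\<close>).  As the
right-hand side is continuous in time, the equation then holds at every positive time
(\<open>derivative_everywhere_of_where_differentiable\<close>), and sub- and supersolutions can be compared with \<open>u\<close>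
(\<open>comparison_principle\<close>).

Upper bound.  Because \<open>u * (1 - u) \<le> u\<close>, every exponential above is a supersolution
(\<open>exponential_upper_barrier\<close>); all quantiles therefore move at speed at most \<open>v \<zeta>\<close>, and \<open>\<zeta>\<close> can be
taken to be the minimiser.

Lower bound.  Let \<open>V\<close> be below the critical speed.  Replacing \<open>Z\<close> by \<open>min Z b\<close> only slows the particles, and by
compactness \<open>V\<close> is still below all the speeds for the capped jump if \<open>b\<close> is large
(\<open>capped_speed_compactness\<close>); this also covers jumps without exponential moments and minima
attained at the boundary of the domain of finiteness.  With bounded jumps, below the critical speed the characteristic equation has complex instead of real
roots, and the real part of the exponential, cut off to a single hump \<open>exp (- a * y) * cos (k * y)\<close> of
height small enough to absorb the quadratic term, is a compactly supported subsolution of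
speed above \<open>V\<close> (\<open>subcritical_hump_parameters\<close>, \<open>travelling_hump_lower_barrier\<close>).  It keeps \<open>u\<close> above a
positive constant at a point moving with that speed.  At a fixed place \<open>u\<close> grows at least logistically
(\<open>logistic_growth\<close>), because mass only arrives from the left where \<open>u\<close> is larger; after a further
bounded time \<open>u\<close> is as close to 1 as desired, so every quantile follows the hump with bounded delay.\<close>

section \<open>A monotone Lipschitz function of one variable has a derivative almost everywhere\<close>

text \<open>The Vitali covering theorem for intervals that need not be centred at the covered point.  The
intervals are disjoint with their end points, but the cover uses their interiors, so that it is open and the
covering can be repeated inside it.\<close>

lemma vitali_intervals:
  fixes E U :: "real set" and R :: "real \<Rightarrow> real \<Rightarrow> bool"
  assumes "open U"
    and R: "\<And>x d. \<lbrakk>x \<in> E; 0 < d\<rbrakk> \<Longrightarrow> \<exists>a b. a < b \<and> x \<in> {a..b} \<and> b - a < d \<and> R a b"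
  obtains C :: "(real \<times> real) set" where "countable C"
    "\<And>a b. (a, b) \<in> C \<Longrightarrow> a < b \<and> R a b \<and> {a..b} \<subseteq> U"
    "disjoint_family_on (\<lambda>(a, b). {a..b}) C"
    "negligible (E \<inter> U - (\<Union>(a, b)\<in>C. {a<..<b}))"
proof -
  define K where "K = {(a, b). a < b \<and> R a b \<and> {a..b} \<subseteq> U}"
  define m where "m = (\<lambda>(a, b). (a + b) / 2 :: real)"
  define r where "r = (\<lambda>(a, b). (b - a) / 2 :: real)"
  have ball: "cball (m i) (r i) = (case i of (a, b) \<Rightarrow> {a..b})" for i
    by (auto simp: m_def r_def dist_real_def abs_le_iff field_simps split: prod.splits)
  have "\<exists>i. i \<in> K \<and> x \<in> cball (m i) (r i) \<and> r i < d" if x: "x \<in> E \<inter> U" and "0 < d" for x d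
  proof -
    obtain e where e: "e > 0" "ball x e \<subseteq> U"
      using assms(1) x by (meson Int_iff openE)
    obtain a b where ab: "a < b" "x \<in> {a..b}" "b - a < min d e" "R a b"
      using R[of x "min d e"] x \<open>0 < d\<close> \<open>e > 0\<close> by auto
    have "{a..b} \<subseteq> ball x e"
      using ab by (auto simp: dist_real_def)
    then have "(a, b) \<in> K"
      using ab e by (auto simp: K_def)
    moreover have "r (a, b) < d" using ab by (simp add: r_def)
    ultimately show ?thesis using ab by (intro exI[of _ "(a, b)"]) (auto simp: ball)
  qed
  moreover have "0 < r i" if "i \<in> K" for i
    using that by (auto simp: K_def r_def)
  ultimately obtain C where C: "countable C" "C \<subseteq> K"
    "pairwise (\<lambda>i j. disjnt (cball (m i) (r i)) (cball (m j) (r j))) C"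
    "negligible (E \<inter> U - (\<Union>i\<in>C. cball (m i) (r i)))"
    using Vitali_covering_theorem_cballs[of K r "E \<inter> U" m, where thesis = thesis] by blast
  show thesis
  proof
    show "countable C" by fact
    show "a < b \<and> R a b \<and> {a..b} \<subseteq> U" if "(a, b) \<in> C" for a b
      using that C(2) by (auto simp: K_def)
    show "disjoint_family_on (\<lambda>(a, b). {a..b}) C"
      using C(3) unfolding ball disjoint_family_on_def pairwise_def disjnt_def by blast
    have "countable (fst ` C \<union> snd ` C)" using C(1) by simp
    then have "negligible (fst ` C \<union> snd ` C)"
      by (simp add: negligible_iff_null_sets countable_imp_null_set_lborel null_sets_completionI)
    with C(4) have "negligible (E \<inter> U - (\<Union>i\<in>C. cball (m i) (r i)) \<union> (fst ` C \<union> snd ` C))"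
      by simp
    then show "negligible (E \<inter> U - (\<Union>(a, b)\<in>C. {a<..<b}))"
    proof (rule negligible_subset)
      have "x \<in> fst ` C \<union> snd ` C"
        if "(a, b) \<in> C" "x \<in> {a..b}" "x \<notin> {a<..<b}" for a b x
        using that by (force simp: image_iff)
      then show "E \<inter> U - (\<Union>(a, b)\<in>C. {a<..<b})
          \<subseteq> E \<inter> U - (\<Union>i\<in>C. cball (m i) (r i)) \<union> (fst ` C \<union> snd ` C)"
        unfolding ball by blast
    qed
  qed
qed

text \<open>Slopes over arbitrarily short intervals that contain \<open>x\<close>, possibly as an end point.  Working with all
such intervals at once replaces the usual comparison of the four Dini derivatives.\<close>

definition straddling_slope :: "(real \<Rightarrow> real) \<Rightarrow> (real \<Rightarrow> bool) \<Rightarrow> real \<Rightarrow> bool" where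
  "straddling_slope h Q x \<longleftrightarrow>
     (\<forall>d>0. \<exists>a b. a < b \<and> x \<in> {a..b} \<and> b - a < d \<and> Q ((h b - h a) / (b - a)))"

text \<open>Cover \<open>E\<close> within \<open>U\<close> by intervals on which \<open>h\<close> grows with slope below \<open>p\<close>, and then within these by intervals on
which it grows with slope above \<open>q\<close>.  The increment of \<open>h\<close> over the second family is at least \<open>q\<close> times its
length, and at most the increment over the first family, hence at most \<open>p\<close> times the length of \<open>U\<close>.\<close>

lemma slope_gap_shrinks:
  fixes h :: "real \<Rightarrow> real"
  assumes mono: "\<And>x y. x \<le> y \<Longrightarrow> h x \<le> h y" and cont: "\<And>a. continuous (at_right a) h"
    and "0 \<le> p" "0 \<le> q" "open U"
    and E: "\<And>x. x \<in> E \<Longrightarrow> straddling_slope h (\<lambda>s. s < p) x \<and> straddling_slope h (\<lambda>s. q < s) x"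
  shows "\<exists>V. open V \<and> V \<subseteq> U \<and> negligible (E \<inter> U - V) \<and>
           ennreal q * emeasure lborel V \<le> ennreal p * emeasure lborel U"
proof -
  let ?\<mu> = "interval_measure h"
  have \<mu>: "emeasure ?\<mu> {a<..b} = ennreal (h b - h a)" if "a \<le> b" for a b
    using emeasure_interval_measure_Ioc[OF that mono cont] .
  have "\<exists>a b. a < b \<and> x \<in> {a..b} \<and> b - a < d \<and> h b - h a \<le> p * (b - a)"
    if xd: "x \<in> E" "0 < d" for x d
  proof -
    obtain a b where "a < b" "x \<in> {a..b}" "b - a < d" "(h b - h a) / (b - a) < p"
      using E[OF xd(1)] xd(2) unfolding straddling_slope_def by blast
    then show ?thesis by (intro exI[of _ a] exI[of _ b]) (auto simp: divide_less_eq)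
  qed
  then obtain C where C: "countable C" "\<And>a b. (a, b) \<in> C \<Longrightarrow> a < b \<and> h b - h a \<le> p * (b - a) \<and> {a..b} \<subseteq> U"
    "disjoint_family_on (\<lambda>(a, b). {a..b}) C" "negligible (E \<inter> U - (\<Union>(a, b)\<in>C. {a<..<b}))"
    using vitali_intervals[OF \<open>open U\<close>, of E "\<lambda>a b. h b - h a \<le> p * (b - a)"] by blast
  define W where "W = (\<Union>(a, b)\<in>C. {a<..<b})"
  have "open W" unfolding W_def by (auto intro!: open_UN)
  have WU: "W \<subseteq> U" using C(2) unfolding W_def by fastforce
  have dC: "disjoint_family_on (\<lambda>(a, b). {a<..<b}) C"
    using C(3) unfolding disjoint_family_on_def by fastforce
  have "emeasure ?\<mu> W = (\<integral>\<^sup>+i. emeasure ?\<mu> (case i of (a, b) \<Rightarrow> {a<..<b}) \<partial>count_space C)"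
    unfolding W_def by (intro emeasure_UN_countable C dC) auto
  also have "\<dots> \<le> (\<integral>\<^sup>+i. ennreal p * emeasure lborel (case i of (a, b) \<Rightarrow> {a<..<b}) \<partial>count_space C)"
  proof (intro nn_integral_mono, clarsimp)
    fix a b assume "(a, b) \<in> C"
    with C(2) have ab: "a < b" "h b - h a \<le> p * (b - a)" by auto
    have "emeasure ?\<mu> {a<..<b} \<le> emeasure ?\<mu> {a<..b}"
      by (intro emeasure_mono) auto
    also have "\<dots> \<le> ennreal (p * (b - a))"
      using ab by (simp add: \<mu> ennreal_leI)
    finally show "emeasure ?\<mu> {a<..<b} \<le> ennreal p * emeasure lborel {a<..<b}"
      using ab \<open>0 \<le> p\<close> by (simp add: ennreal_mult)
  qed
  also have "\<dots> = ennreal p * emeasure lborel W"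
    unfolding W_def using C dC
    by (subst emeasure_UN_countable) (auto simp: nn_integral_cmult)
  also have "\<dots> \<le> ennreal p * emeasure lborel U"
    using WU \<open>open U\<close> by (intro mult_left_mono emeasure_mono) auto
  finally have upper: "emeasure ?\<mu> W \<le> ennreal p * emeasure lborel U" .

  have "\<exists>a b. a < b \<and> x \<in> {a..b} \<and> b - a < d \<and> q * (b - a) \<le> h b - h a"
    if xd: "x \<in> E" "0 < d" for x d
  proof -
    obtain a b where "a < b" "x \<in> {a..b}" "b - a < d" "q < (h b - h a) / (b - a)"
      using E[OF xd(1)] xd(2) unfolding straddling_slope_def by blast
    then show ?thesis by (intro exI[of _ a] exI[of _ b]) (auto simp: less_divide_eq)
  qed
  then obtain D where D: "countable D" "\<And>a b. (a, b) \<in> D \<Longrightarrow> a < b \<and> q * (b - a) \<le> h b - h a \<and> {a..b} \<subseteq> W"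
    "disjoint_family_on (\<lambda>(a, b). {a..b}) D" "negligible (E \<inter> W - (\<Union>(a, b)\<in>D. {a<..<b}))"
    using vitali_intervals[OF \<open>open W\<close>, of E "\<lambda>a b. q * (b - a) \<le> h b - h a"] by blast
  define V where "V = (\<Union>(a, b)\<in>D. {a<..<b})"
  have "open V" unfolding V_def by (auto intro!: open_UN)
  have dD: "disjoint_family_on (\<lambda>(a, b). {a<..<b}) D" "disjoint_family_on (\<lambda>(a, b). {a<..b}) D"
    using D(3) unfolding disjoint_family_on_def by fastforce+
  have "ennreal q * emeasure lborel V
      = (\<integral>\<^sup>+i. ennreal q * emeasure lborel (case i of (a, b) \<Rightarrow> {a<..<b}) \<partial>count_space D)"
    unfolding V_def using D dD
    by (subst emeasure_UN_countable) (auto simp: nn_integral_cmult)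
  also have "\<dots> \<le> (\<integral>\<^sup>+i. emeasure ?\<mu> (case i of (a, b) \<Rightarrow> {a<..b}) \<partial>count_space D)"
  proof (intro nn_integral_mono, clarsimp)
    fix a b assume "(a, b) \<in> D"
    with D(2) have ab: "a < b" "q * (b - a) \<le> h b - h a" by auto
    then show "ennreal q * emeasure lborel {a<..<b} \<le> emeasure ?\<mu> {a<..b}"
      using \<open>0 \<le> q\<close> by (simp add: \<mu> ennreal_leI flip: ennreal_mult)
  qed
  also have "\<dots> = emeasure ?\<mu> (\<Union>(a, b)\<in>D. {a<..b})"
    using D dD by (subst emeasure_UN_countable) auto
  also have "\<dots> \<le> emeasure ?\<mu> W"
    using D(2) \<open>open W\<close> by (intro emeasure_mono) fastforce+
  also note upper
  finally have "ennreal q * emeasure lborel V \<le> ennreal p * emeasure lborel U" .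
  moreover have "V \<subseteq> U" using D(2) WU unfolding V_def by fastforce
  moreover have "negligible (E \<inter> U - V)"
    by (rule negligible_subset[OF negligible_Un[OF C(4) D(4)]]) (auto simp: W_def V_def)
  ultimately show ?thesis using \<open>open V\<close> by blast
qed

text \<open>Iterating the previous lemma covers the set, up to null sets, by open sets whose measures decrease like
\<open>(p / q) ^ n\<close>.\<close>

lemma slope_gap_negligible:
  fixes h :: "real \<Rightarrow> real"
  assumes mono: "\<And>x y. x \<le> y \<Longrightarrow> h x \<le> h y" and cont: "\<And>a. continuous (at_right a) h"
    and "0 \<le> p" "p < q"
  shows "negligible {x. straddling_slope h (\<lambda>s. s < p) x \<and> straddling_slope h (\<lambda>s. q < s) x}"
    (is "negligible ?E")
proof (rule negligible_on_intervals[THEN iffD2, rule_format])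
  fix a b :: real
  let ?U = "{a - 1<..<b + 1}"
  have "\<exists>V. open V \<and> V \<subseteq> ?U \<and> negligible (?E \<inter> ?U - V) \<and>
          emeasure lborel V \<le> ennreal ((p / q) ^ n * \<bar>b + 1 - (a - 1)\<bar>)" for n
  proof (induction n)
    case 0
    show ?case by (intro exI[of _ ?U]) (cases "a - 1 \<le> b + 1"; simp)
  next
    case (Suc n)
    then obtain V where V: "open V" "V \<subseteq> ?U" "negligible (?E \<inter> ?U - V)"
      "emeasure lborel V \<le> ennreal ((p / q) ^ n * \<bar>b + 1 - (a - 1)\<bar>)" by blast
    obtain V' where V': "open V'" "V' \<subseteq> V" "negligible (?E \<inter> V - V')"
      "ennreal q * emeasure lborel V' \<le> ennreal p * emeasure lborel V"
      using slope_gap_shrinks[OF mono cont \<open>0 \<le> p\<close> _ \<open>open V\<close>, of q ?E] assms(3,4) by auto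
    have "ennreal q * emeasure lborel V' \<le> ennreal p * ennreal ((p / q) ^ n * \<bar>b + 1 - (a - 1)\<bar>)"
      using V'(4) V(4) by (meson mult_left_mono order_trans zero_le)
    also have "\<dots> = ennreal q * ennreal ((p / q) ^ Suc n * \<bar>b + 1 - (a - 1)\<bar>)"
      using assms(3,4) by (simp flip: ennreal_mult)
    finally have "emeasure lborel V' \<le> ennreal ((p / q) ^ Suc n * \<bar>b + 1 - (a - 1)\<bar>)"
      using assms(3,4) by (subst (asm) ennreal_mult_le_mult_iff) auto
    moreover have "negligible (?E \<inter> ?U - V')"
      by (rule negligible_subset[OF negligible_Un[OF V(3) V'(3)]]) auto
    ultimately show ?case using V' V(2) by blast
  qed
  note iterate = this
  have "negligible (?E \<inter> ?U)"
  proof (rule negligible_outer_le[THEN iffD2, rule_format])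
    fix e :: real assume "e > 0"
    have "(\<lambda>n. (p / q) ^ n * \<bar>b + 1 - (a - 1)\<bar>) \<longlonglongrightarrow> 0 * \<bar>b + 1 - (a - 1)\<bar>"
      using assms(3,4) by (intro tendsto_mult_right LIMSEQ_power_zero) auto
    then have "\<forall>\<^sub>F n in sequentially. (p / q) ^ n * \<bar>b + 1 - (a - 1)\<bar> < e"
      using \<open>e > 0\<close> by (intro order_tendstoD(2)) auto
    then obtain n where n: "(p / q) ^ n * \<bar>b + 1 - (a - 1)\<bar> < e"
      by (meson eventually_sequentially order_refl)
    obtain V where V: "open V" "negligible (?E \<inter> ?U - V)"
      "emeasure lborel V \<le> ennreal ((p / q) ^ n * \<bar>b + 1 - (a - 1)\<bar>)" using iterate by blast
    let ?N = "?E \<inter> ?U - V"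
    have "emeasure lborel V \<le> ennreal e"
      using V(3) n by (meson ennreal_leI less_imp_le order_trans)
    then have Vn: "emeasure lebesgue V \<le> ennreal e" using V(1) by simp
    then have "emeasure lebesgue V < \<infinity>" by (rule le_less_trans) simp
    then have "V \<in> lmeasurable" using V(1) by (intro fmeasurableI) auto
    moreover have "measure lebesgue V \<le> e"
      using Vn \<open>e > 0\<close> by (simp add: measure_def enn2real_leI)
    moreover have "?N \<in> lmeasurable" "measure lebesgue ?N = 0"
      using V(2) by (auto simp: negligible_iff_measure)
    ultimately have "?N \<union> V \<in> lmeasurable" "measure lebesgue (?N \<union> V) \<le> e"
      using measure_Un_le[of ?N lebesgue V] fmeasurable.Un[of ?N lebesgue V] by (auto simp: fmeasurableD)
    then show "\<exists>T. ?E \<inter> ?U \<subseteq> T \<and> T \<in> lmeasurable \<and> measure lebesgue T \<le> e"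
      by (intro exI[of _ "?N \<union> V"] conjI) auto
  qed
  moreover have "cbox a b \<subseteq> ?U" by (auto simp: cbox_interval)
  ultimately show "negligible (?E \<inter> cbox a b)" by (rule negligible_subset[OF _ Int_mono[OF subset_refl]])
qed

text \<open>Away from the null sets of the previous lemma, for rational \<open>p < q\<close>, the slopes over short intervals
around \<open>x\<close> have only one limit point; it is finite because the slopes lie between 0 and \<open>L\<close>.\<close>

lemma lipschitz_mono_differentiable_ae:
  fixes h :: "real \<Rightarrow> real"
  assumes mono: "\<And>x y. x \<le> y \<Longrightarrow> h x \<le> h y" and lip: "\<And>x y. \<bar>h x - h y\<bar> \<le> L * \<bar>x - y\<bar>"
  shows "negligible {x. \<not> h differentiable at x}"
proof -
  have cont: "continuous (at_right a) h" for a
  proof -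
    have "L \<ge> 0" using lip[of 0 1] by simp
    have "L-lipschitz_on UNIV h"
      by (rule lipschitz_onI) (auto simp: dist_real_def lip \<open>L \<ge> 0\<close>)
    then show ?thesis
      by (meson continuous_on_eq_continuous_within continuous_within_subset iso_tuple_UNIV_I lipschitz_on_continuous_on subset_UNIV)
  qed
  have bound: "0 \<le> (h b - h a) / (b - a) \<and> (h b - h a) / (b - a) \<le> L" if "a < b" for a b
    using mono[of a b] lip[of b a] that by (auto simp: divide_le_eq)
  let ?E = "\<lambda>p q. {x. straddling_slope h (\<lambda>s. s < p) x \<and> straddling_slope h (\<lambda>s. q < s) x}"
  let ?N = "\<Union>p\<in>\<rat>. \<Union>q\<in>{q\<in>\<rat>. 0 \<le> p \<and> p < q}. ?E p q"
  have "negligible ?N"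
    by (intro negligible_countable_Union countable_image countable_rat)
      (auto intro!: negligible_countable_Union countable_image intro: slope_gap_negligible[OF mono cont]
        countable_subset[OF _ countable_rat])
  moreover have "h differentiable at x" if x: "x \<notin> ?N" for x
  proof -
    define around where "around d Q \<longleftrightarrow>
      (\<forall>a b. a < b \<and> x \<in> {a..b} \<and> b - a < d \<longrightarrow> Q ((h b - h a) / (b - a)))" for d and Q :: "real \<Rightarrow> bool"
    have around: "Q ((h b - h a) / (b - a))" if "around d Q" "a < b" "x \<in> {a..b}" "b - a < d" for d Q a b
      using that unfolding around_def by blast
    have straddling: "straddling_slope h Q x \<longleftrightarrow> (\<forall>d>0. \<not> around d (\<lambda>s. \<not> Q s))" for Q
      unfolding straddling_slope_def around_def by blast
    let ?A = "{p. \<exists>d>0. around d (\<lambda>s. p \<le> s)}"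
    \<comment> \<open>\<open>?A\<close> collects the eventual lower bounds of the slopes, so \<open>D\<close> is their lower limit.\<close>
    define D where "D = Sup ?A"
    have "around 1 (\<lambda>s. 0 \<le> s)" using bound by (simp add: around_def)
    then have "0 \<in> ?A" using zero_less_one by blast
    have AL: "p \<le> L" if p: "p \<in> ?A" for p
    proof -
      obtain d where d: "d > 0" "around d (\<lambda>s. p \<le> s)" using p by blast
      show ?thesis using around[OF d(2), of x "x + d/2"] d(1) bound[of x "x + d/2"] by auto
    qed
    then have bdd: "bdd_above ?A" by (intro bdd_aboveI[of _ L]) auto
    have D: "D \<ge> p" if "p \<in> ?A" for p unfolding D_def by (rule cSup_upper[OF that bdd])
    have "D \<ge> 0" by (rule D) fact
    have key: "\<exists>d>0. around d (\<lambda>s. \<bar>s - D\<bar> < e)" if "e > 0" for e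
    proof -
      obtain p' where p': "p' \<in> ?A" "D - e < p'"
        using less_cSupE[of "D - e" ?A] \<open>0 \<in> ?A\<close> \<open>e > 0\<close> unfolding D_def by auto
      from p'(1) obtain d1 where d1: "d1 > 0" "around d1 (\<lambda>s. p' \<le> s)" by blast
      obtain p where p: "p \<in> \<rat>" "D < p" "p < D + e" using Rats_dense_in_real[of D "D + e"] \<open>e > 0\<close> by auto
      obtain q where q: "q \<in> \<rat>" "p < q" "q < D + e" using Rats_dense_in_real[of p "D + e"] p by auto
      have "p \<notin> ?A" using D[of p] p by force
      then have "straddling_slope h (\<lambda>s. s < p) x" unfolding straddling not_less by blast
      moreover have "x \<notin> ?E p q" using x p q \<open>D \<ge> 0\<close> by auto
      ultimately have "\<not> straddling_slope h (\<lambda>s. q < s) x" by simp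
      then obtain d2 where d2: "d2 > 0" "around d2 (\<lambda>s. s \<le> q)"
        unfolding straddling by (auto simp: not_less)
      have "\<bar>s - D\<bar> < e" if "p' \<le> s" "s \<le> q" for s
        using that q p'(2) unfolding abs_less_iff by linarith
      then have "around (min d1 d2) (\<lambda>s. \<bar>s - D\<bar> < e)"
        using around[OF d1(2)] around[OF d2(2)] unfolding around_def[of "min d1 d2"] by simp
      then show ?thesis using d1 d2 by (intro exI[of _ "min d1 d2"]) auto
    qed
    have "((\<lambda>y. (h y - h x) / (y - x)) \<longlongrightarrow> D) (at x)"
    proof (rule LIM_I)
      fix e :: real assume "e > 0"
      from key[OF this] obtain d where d: "d > 0" "around d (\<lambda>s. \<bar>s - D\<bar> < e)" by blast
      have "norm ((h y - h x) / (y - x) - D) < e" if "y \<noteq> x" "norm (y - x) < d" for y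
      proof (cases "x < y")
        case True
        then show ?thesis using around[OF d(2), of x y] that by simp
      next
        case False
        have "(h y - h x) / (y - x) = (h x - h y) / (x - y)"
          by (metis minus_diff_eq minus_divide_divide)
        then show ?thesis using around[OF d(2), of y x] that False by simp
      qed
      then show "\<exists>s>0. \<forall>y. y \<noteq> x \<and> norm (y - x) < s \<longrightarrow> norm ((h y - h x) / (y - x) - D) < e"
        using d(1) by blast
    qed
    then have "(h has_field_derivative D) (at x)" by (simp add: has_field_derivative_iff)
    then show ?thesis by (auto simp: differentiable_def has_field_derivative_def)
  qed
  ultimately show ?thesis by - (rule negligible_subset[of ?N], blast+)
qed

text \<open>Sard's theorem in dimension one, transported from one-dimensional vectors to the reals.\<close>

lemma negligible_image_zero_derivative:
  fixes k :: "real \<Rightarrow> real"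
  assumes "\<And>x. x \<in> S \<Longrightarrow> (k has_real_derivative 0) (at x within S)"
  shows "negligible (k ` S)"
proof -
  let ?v = "vec :: real \<Rightarrow> real^1"
  let ?k = "\<lambda>x::real^1. ?v (k (x $ 1))"
  have "negligible (?k ` (?v ` S))"
  proof (rule baby_Sard)
    fix x assume "x \<in> ?v ` S"
    then obtain s where s: "s \<in> S" "x = ?v s" by blast
    have 1: "(k has_derivative (\<lambda>_. 0)) (at (x $ 1) within (\<lambda>x. x $ 1) ` (?v ` S))"
      using assms[OF s(1)] s by (simp add: has_field_derivative_def image_image mult_zero_left[abs_def])
    have 2: "((\<lambda>x::real^1. x $ 1) has_derivative (\<lambda>x. x $ 1)) (at x within ?v ` S)"
      by (intro bounded_linear_imp_has_derivative bounded_linear_vec_nth)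
    have 3: "(?v has_derivative ?v) F" for F
      by (intro bounded_linear_imp_has_derivative) (simp add: linear_linear linear_vec)
    have "((\<lambda>x::real^1. k (x $ 1)) has_derivative (\<lambda>_. 0)) (at x within ?v ` S)"
      using diff_chain_within[OF 2 1] by (simp add: o_def)
    from has_derivative_compose[OF this 3]
    show "(?k has_derivative (\<lambda>_. 0)) (at x within ?v ` S)" by simp
  next
    have "matrix (\<lambda>_::real^1. 0::real^1) = 0" by (simp add: matrix_def vec_eq_iff)
    then show "rank (matrix (\<lambda>_::real^1. 0::real^1)) < CARD(1)" by simp
  qed simp
  then have "negligible ((\<lambda>x. x $ 1) ` ?k ` (?v ` S))"
  proof (rule negligible_locally_Lipschitz_image[rotated])
    have "norm (y $ 1 - x $ 1) \<le> 1 * norm (y - x)" for x y :: "real^1"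
      using component_le_norm_cart[of "y - x" 1] by simp
    then show "\<exists>T B. open T \<and> x \<in> T \<and> (\<forall>y\<in>?k ` ?v ` S \<inter> T. norm (y $ 1 - x $ 1) \<le> B * norm (y - x))" for x :: "real^1"
      by blast
  qed simp
  then show ?thesis by (simp add: image_image)
qed

text \<open>Subtract from \<open>h\<close> the integral of \<open>g\<close>.  The difference \<open>k\<close> is Lipschitz on bounded intervals and has derivative 0
wherever \<open>h\<close> is differentiable, that is, off a null set.  A Lipschitz function maps the null set to a null set,
and the set with zero derivative is mapped to a null set as well, so the image of an interval under \<open>k\<close> is a connected null
set and \<open>k\<close> is constant.\<close>

lemma derivative_everywhere_of_where_differentiable:
  fixes h g :: "real \<Rightarrow> real"
  assumes anti: "antimono_on {0..} h" and lip: "L-lipschitz_on {0..} h"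
    and g: "continuous_on {0..} g"
    and der: "\<And>t. \<lbrakk>0 \<le> t; h differentiable (at t within {0..})\<rbrakk>
                \<Longrightarrow> (h has_real_derivative g t) (at t within {0..})"
    and "0 < t"
  shows "(h has_real_derivative g t) (at t)"
proof -
  define H where "H t = - h (max 0 t)" for t
  define G where "G t = integral {0..t} g" for t
  have "H x \<le> H y" if "x \<le> y" for x y
    using anti that unfolding H_def by (auto intro!: monotone_onD[OF anti])
  moreover have "\<bar>H x - H y\<bar> \<le> L * \<bar>x - y\<bar>" for x y
  proof -
    have "\<bar>H x - H y\<bar> \<le> L * \<bar>max 0 x - max 0 y\<bar>"
      using lipschitz_onD[OF lip, of "max 0 x" "max 0 y"] by (simp add: H_def dist_real_def abs_minus_commute)
    also have "\<dots> \<le> L * \<bar>x - y\<bar>"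
      by (intro mult_left_mono lipschitz_on_nonneg[OF lip]) auto
    finally show ?thesis .
  qed
  ultimately have neg: "negligible {x. \<not> H differentiable at x}"
    by (rule lipschitz_mono_differentiable_ae)
  have hH: "h x = - H x" if "x \<ge> 0" for x using that by (simp add: H_def)
  \<comment> \<open>A margin beyond \<open>t\<close> makes \<open>t\<close> an interior point of the interval.\<close>
  define T where "T = t + 1"
  have cont0T: "continuous_on {0..T} g" by (rule continuous_on_subset[OF g]) auto
  have G: "(G has_real_derivative g x) (at x within {0..T})" if "x \<in> {0..T}" for x
    unfolding G_def using integral_has_real_derivative[OF cont0T that] .
  define k where "k x = h x - G x" for x
  let ?Z = "{0<..<T} \<inter> {x. H differentiable at x}"
  have "(k has_real_derivative 0) (at x within ?Z)" if "x \<in> ?Z" for x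
  proof -
    have "h differentiable (at x within {0..})"
    proof (rule differentiable_transform_within[OF _ zero_less_one])
      show "(\<lambda>x. - H x) differentiable at x within {0..}"
        using that by (intro differentiable_minus) (auto intro: differentiable_at_withinI)
    qed (use that in \<open>auto simp: hH\<close>)
    then have "(h has_real_derivative g x) (at x within {0..})" using der that by auto
    then have "(h has_real_derivative g x) (at x within ?Z)" by (rule DERIV_subset) auto
    moreover have "(G has_real_derivative g x) (at x within ?Z)"
      using that by (intro DERIV_subset[OF G]) auto
    ultimately show ?thesis unfolding k_def by (auto intro!: derivative_eq_intros)
  qed
  then have 1: "negligible (k ` ?Z)" by (rule negligible_image_zero_derivative)
  have "bounded (g ` {0..T})"
    by (intro compact_imp_bounded compact_continuous_image cont0T) auto
  then obtain B where "\<forall>y\<in>g ` {0..T}. norm y \<le> B" unfolding bounded_iff by blast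
  then have B: "\<bar>g x\<bar> \<le> B" if "x \<in> {0..T}" for x using that by simp
  have Glip: "\<bar>G y - G x\<bar> \<le> B * \<bar>y - x\<bar>" if "x \<in> {0..T}" "y \<in> {0..T}" for x y
    using field_differentiable_bound[of "{0..T}" G g B y x] G B that by auto
  have klip: "\<bar>k y - k x\<bar> \<le> (L + B) * \<bar>y - x\<bar>" if "x \<in> {0..T}" "y \<in> {0..T}" for x y
    using Glip[OF that] lipschitz_onD[OF lip, of y x] that
    by (simp add: k_def dist_real_def distrib_right)
  let ?N = "{0..T} \<inter> ({x. \<not> H differentiable at x} \<union> {0, T})"
  have "negligible (k ` ?N)"
  proof (rule negligible_locally_Lipschitz_image)
    show "negligible ?N" using neg by (intro negligible_Int) auto
    show "\<exists>U C. open U \<and> x \<in> U \<and> (\<forall>y\<in>?N \<inter> U. norm (k y - k x) \<le> C * norm (y - x))" if "x \<in> ?N" for x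
    proof (intro exI[of _ UNIV] exI[of _ "L + B"] conjI ballI)
      fix y assume "y \<in> ?N \<inter> UNIV"
      then show "norm (k y - k x) \<le> (L + B) * norm (y - x)"
        using klip[of x y] that by (simp only: real_norm_def Int_iff)
    qed auto
  qed simp
  with 1 have "negligible (k ` ?Z \<union> k ` ?N)" by simp
  then have neg: "negligible (k ` {0..T})" by (rule negligible_subset) (use \<open>0 < t\<close> in \<open>force simp: T_def\<close>)
  have "L + B \<ge> 0"
    using B[of 0] lipschitz_on_nonneg[OF lip] \<open>0 < t\<close> by (simp add: T_def)
  then have "(L + B)-lipschitz_on {0..T} k"
    using klip by (intro lipschitz_onI) (auto simp: dist_real_def)
  then have "continuous_on {0..T} k" by (rule lipschitz_on_continuous_on)
  then have conn: "connected (k ` {0..T})" by (intro connected_continuous_image) auto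
  have const: "k x = k 0" if "x \<in> {0..T}" for x
  proof (rule ccontr)
    assume "k x \<noteq> k 0"
    moreover have "{min (k x) (k 0)..max (k x) (k 0)} \<subseteq> k ` {0..T}"
      using connectedD_interval[OF conn, of "k x" "k 0"] connectedD_interval[OF conn, of "k 0" "k x"] that
      by (auto simp: min_def max_def subset_iff)
    ultimately show False
      using negligible_subset[OF neg] negligible_interval(1)[of "min (k x) (k 0)" "max (k x) (k 0)"]
      by (force simp: cbox_interval box_eq_empty)
  qed
  have "(k has_real_derivative 0) (at t)"
  proof (rule has_field_derivative_transform_within_open[OF DERIV_const[of "k 0"]])
    show "open {0<..<T}" "t \<in> {0<..<T}" using \<open>0 < t\<close> by (simp_all add: T_def)
    show "k 0 = k x" if "x \<in> {0<..<T}" for x using const[of x] that by simp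
  qed
  moreover have "(G has_real_derivative g t) (at t)"
    using G[of t] \<open>0 < t\<close> by (simp add: at_within_Icc_at T_def)
  ultimately have "((\<lambda>x. k x + G x) has_real_derivative 0 + g t) (at t)" by (rule DERIV_add)
  then show ?thesis by (simp add: k_def)
qed

section \<open>A comparison principle\<close>

text \<open>The derivatives are compared only where \<open>g\<close> exceeds \<open>h\<close>: from the last time with \<open>g \<le> h\<close> on, the
difference cannot increase.  This is what allows barriers that are not differentiable where they vanish.\<close>

lemma crossing_bound:
  fixes g h :: "real \<Rightarrow> real"
  assumes "0 \<le> t" "continuous_on {0..t} g" "continuous_on {0..t} h" "g 0 \<le> h 0"
    and der: "\<And>s. \<lbrakk>0 < s; s < t; h s < g s\<rbrakk>
      \<Longrightarrow> \<exists>D E. (g has_real_derivative D) (at s) \<and> (h has_real_derivative E) (at s) \<and> D \<le> E"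
  shows "g t \<le> h t"
proof (rule ccontr)
  assume neg: "\<not> g t \<le> h t"
  define d where "d s = g s - h s" for s
  have d: "continuous_on {0..t} d" unfolding d_def using assms by (intro continuous_intros)
  have "compact ({0..t} \<inter> d -` {..0})"
    using continuous_closed_preimage[OF d closed_atLeastAtMost closed_atMost]
    by (intro compact_Int_closed[of "{0..t}" "{0..t} \<inter> d -` {..0}", simplified Int_left_absorb]) auto
  moreover have "0 \<in> {0..t} \<inter> d -` {..0}" using assms by (simp add: d_def)
  ultimately obtain s where s: "s \<in> {0..t}" "d s \<le> 0" "\<And>r. r \<in> {0..t} \<Longrightarrow> d r \<le> 0 \<Longrightarrow> r \<le> s"
    using compact_attains_sup[of "{0..t} \<inter> d -` {..0}"] by blast
  have "s < t" using s neg by (cases "s = t") (auto simp: d_def)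
  have der': "\<exists>D\<le>0. (d has_real_derivative D) (at r)" if r: "s < r" "r < t" for r
  proof -
    have "h r < g r" using s(1) s(3)[of r] r by (force simp: d_def)
    then obtain D E where "(g has_real_derivative D) (at r)" "(h has_real_derivative E) (at r)" "D \<le> E"
      using der[of r] r s(1) by auto
    then show ?thesis unfolding d_def by (intro exI[of _ "D - E"]) (auto intro: DERIV_diff)
  qed
  then obtain D where D: "\<And>r. s < r \<Longrightarrow> r < t \<Longrightarrow> D r \<le> 0 \<and> (d has_real_derivative D r) (at r)" by metis
  obtain \<xi> where "s < \<xi>" "\<xi> < t" "d t - d s = D \<xi> * (t - s)"
    using mvt[OF \<open>s < t\<close>, of d "\<lambda>r. (*) (D r)"] continuous_on_subset[OF d, of "{s..t}"] D s(1)
    by (auto simp: has_field_derivative_def)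
  with D[of \<xi>] \<open>s < t\<close> s(2) have "d t \<le> 0"
    by (smt (verit) mult_nonpos_nonneg)
  with neg show False by (simp add: d_def)
qed

text \<open>Here \<open>\<phi>\<close> stands for a subsolution minus a supersolution of an equation whose right-hand side at \<open>(t, x)\<close> depends on
the whole profile at time \<open>t\<close>.  The hypothesis on the derivative says that, where \<open>\<phi>\<close> is positive, it grows at a rate
at most \<open>C\<close> times the supremum of the profile.  Then the least nonnegative \<open>B\<close> with \<open>\<phi> t x \<le> B * exp (2 * C * t)\<close>
can be halved, so it is 0.\<close>

lemma comparison_principle:
  fixes \<phi> :: "real \<Rightarrow> real \<Rightarrow> real"
  assumes "0 \<le> C" and le1: "\<And>t x. 0 \<le> t \<Longrightarrow> \<phi> t x \<le> 1" and init: "\<And>x. \<phi> 0 x \<le> 0"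
    and cont: "\<And>x. continuous_on {0..} (\<lambda>t. \<phi> t x)"
    and der: "\<And>t x B. \<lbrakk>0 < t; 0 < \<phi> t x; \<And>y. \<phi> t y \<le> B\<rbrakk>
       \<Longrightarrow> \<exists>D\<le>C * B. ((\<lambda>s. \<phi> s x) has_real_derivative D) (at t)"
    and "0 \<le> t"
  shows "\<phi> t x \<le> 0"
proof -
  define K where "K = 2 * C"
  define A where "A = {exp (- K * s) * max 0 (\<phi> s y) | s y. 0 \<le> s}"
  define B where "B = Sup A"
  have "K \<ge> 0" using \<open>0 \<le> C\<close> by (simp add: K_def)
  have "a \<le> 1" if "a \<in> A" for a
    using that le1 \<open>K \<ge> 0\<close> by (force simp: A_def intro!: mult_le_one)
  then have "bdd_above A" by (intro bdd_aboveI[of _ 1])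
  then have upper: "exp (- K * s) * max 0 (\<phi> s y) \<le> B" if "0 \<le> s" for s y
    unfolding B_def using that by (intro cSup_upper) (auto simp: A_def)
  have "0 \<le> B" using upper[of 0 0] by simp
  have bound: "max 0 (\<phi> s y) \<le> B * exp (K * s)" if "0 \<le> s" for s y
    using upper[OF that, of y] by (simp add: exp_minus field_simps)
  have half: "\<phi> t x \<le> B / 2 * exp (K * t)" if "0 \<le> t" for t x
  proof (rule crossing_bound[OF that, of "\<lambda>t. \<phi> t x" "\<lambda>t. B / 2 * exp (K * t)"])
    show "continuous_on {0..t} (\<lambda>t. \<phi> t x)" by (rule continuous_on_subset[OF cont]) auto
    show "\<phi> 0 x \<le> B / 2 * exp (K * 0)" using init[of x] \<open>0 \<le> B\<close> by simp
    fix s assume s: "0 < s" "s < t" "B / 2 * exp (K * s) < \<phi> s x"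
    have "0 \<le> B / 2 * exp (K * s)" using \<open>0 \<le> B\<close> by simp
    then have "0 < \<phi> s x" using s(3) by linarith
    moreover have "\<phi> s y \<le> B * exp (K * s)" for y using bound[of s y] s(1) by simp
    ultimately obtain D where D: "D \<le> C * (B * exp (K * s))"
        "((\<lambda>s. \<phi> s x) has_real_derivative D) (at s)"
      using der[OF s(1), of x "B * exp (K * s)"] by blast
    have "((\<lambda>t. B / 2 * exp (K * t)) has_real_derivative C * (B * exp (K * s))) (at s)"
      unfolding K_def by (auto intro!: derivative_eq_intros)
    with D show "\<exists>D E. ((\<lambda>t. \<phi> t x) has_real_derivative D) (at s) \<and>
        ((\<lambda>t. B / 2 * exp (K * t)) has_real_derivative E) (at s) \<and> D \<le> E" by blast
  qed (intro continuous_intros)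
  have "a \<le> B / 2" if a: "a \<in> A" for a
  proof -
    obtain s y where "a = exp (- K * s) * max 0 (\<phi> s y)" "0 \<le> s" using a by (auto simp: A_def)
    moreover have "max 0 (\<phi> s y) \<le> B / 2 * exp (K * s)"
      using half[OF \<open>0 \<le> s\<close>, of y] \<open>0 \<le> B\<close> by (intro max.boundedI) simp_all
    ultimately have "a \<le> exp (- K * s) * (B / 2 * exp (K * s))"
      by (simp only: mult_left_mono exp_ge_zero)
    then show ?thesis by (simp add: exp_minus field_simps)
  qed
  then have "B \<le> B / 2" unfolding B_def[of] by (intro cSup_least) (auto simp: A_def B_def)
  then have "B = 0" using \<open>0 \<le> B\<close> by simp
  then show ?thesis using bound[OF \<open>0 \<le> t\<close>, of x] by simp
qed

section \<open>The evolution equation of the mean-field limit\<close>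

lemma proper_cdfs_properties:
  assumes "F \<in> proper_cdfs"
  shows "mono F" "0 \<le> F x" "F x \<le> 1" "F \<in> borel_measurable borel"
    "(F \<longlongrightarrow> 0) at_bot" "(F \<longlongrightarrow> 1) at_top" "continuous (at_right x) F"
proof -
  obtain M where M: "real_distribution M" "F = cdf M"
    using assms by (auto simp: proper_cdfs_def)
  interpret real_distribution M by fact
  show "mono F" unfolding M(2) mono_def using cdf_nondecreasing by blast
  then show "F \<in> borel_measurable borel" by (rule borel_measurable_mono)
  show "0 \<le> F x" "F x \<le> 1" using M(2) cdf_nonneg cdf_bounded_prob by auto
  show "(F \<longlongrightarrow> 0) at_bot" "(F \<longlongrightarrow> 1) at_top" "continuous (at_right x) F"
    using M(2) cdf_lim_at_bot cdf_lim_at_top_prob cdf_is_right_cont by auto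
qed

lemma interval_measure_cdf:
  assumes "real_distribution M"
  shows "interval_measure (cdf M) = M"
proof -
  have F: "cdf M \<in> proper_cdfs" using assms by (auto simp: proper_cdfs_def)
  note p = proper_cdfs_properties[OF F]
  show ?thesis
    using p by (intro cdf_unique assms real_distribution_interval_measure cdf_interval_measure)
      (auto simp: mono_def)
qed

locale positive_jump = prob_space P for P :: "'w measure" +
  fixes Z :: "'w \<Rightarrow> real"
  assumes Z_measurable [measurable]: "Z \<in> borel_measurable P"
    and Z_pos: "AE \<omega> in P. 0 < Z \<omega>"
begin

definition displaced :: "(real \<Rightarrow> real) \<Rightarrow> real \<Rightarrow> real" where
  "displaced F x = expectation (\<lambda>\<omega>. F (x - Z \<omega>))"

lemma integrable_cdf_displaced:
  assumes "F \<in> proper_cdfs"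
  shows "integrable P (\<lambda>\<omega>. F (x - Z \<omega>))"
proof -
  note p = proper_cdfs_properties[OF assms]
  note [measurable] = p(4)
  show ?thesis using p(2,3) by (intro integrable_const_bound[of _ 1]) auto
qed

text \<open>If \<open>X\<close> has distribution function \<open>F\<close> and is independent of \<open>Z\<close>, both sides are the probability of
\<open>X \<le> x < X + Z\<close>, the rate at which mass jumps over \<open>x\<close>.  As \<open>J\<close> vanishes on the negative reals, the term with
\<open>J\<close> can be integrated over all \<open>y\<close>, which gives the convolution.\<close>

lemma crossing_rate_eq:
  assumes "F \<in> proper_cdfs"
  shows "(LINT y:{..x}|interval_measure F. 1 - cdf (distr P borel Z) (x - y)) = F x - displaced F x"
proof -
  obtain M where M: "real_distribution M" and FM: "F = cdf M"
    using assms by (auto simp: proper_cdfs_def)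
  interpret M: real_distribution M by fact
  interpret MP: pair_prob_space M P ..
  let ?J = "cdf (distr P borel Z)"
  have J: "?J s = expectation (\<lambda>\<omega>. indicator {..s} (Z \<omega>))" for s
  proof -
    have "?J s = measure P (Z -` {..s} \<inter> space P)" unfolding cdf_def by (simp add: measure_distr)
    also have "\<dots> = expectation (indicator (Z -` {..s} \<inter> space P))" by simp
    also have "\<dots> = expectation (\<lambda>\<omega>. indicator {..s} (Z \<omega>))"
      by (intro Bochner_Integration.integral_cong) (auto simp: indicator_def)
    finally show ?thesis .
  qed
  have J0: "?J s = 0" if "s < 0" for s
    unfolding J using Z_pos that by (intro integral_eq_zero_AE) (auto simp: indicator_def)
  have "?J \<in> proper_cdfs" unfolding proper_cdfs_def
    by (auto intro!: exI[of _ "distr P borel Z"] real_distribution_distr)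
  note pJ = proper_cdfs_properties[OF this]
  note [measurable] = pJ(4)
  have int: "integrable M (\<lambda>y. ?J (x - y))"
    using pJ(2,3) by (intro M.integrable_const_bound[of _ 1]) auto
  have int_ind: "integrable M (indicator {..x} :: real \<Rightarrow> real)"
    by (intro M.integrable_const_bound[of _ 1]) auto
  have "(LINT y:{..x}|M. 1 - ?J (x - y)) = (LINT y|M. indicator {..x} y - ?J (x - y))"
    unfolding set_lebesgue_integral_def
    by (intro Bochner_Integration.integral_cong) (auto simp: indicator_def J0)
  also have "\<dots> = F x - (LINT y|M. ?J (x - y))"
    using int int_ind by (subst Bochner_Integration.integral_diff) (auto simp: FM cdf_def)
  also have "(LINT y|M. ?J (x - y)) = (LINT y|M. expectation (\<lambda>\<omega>. indicator {..x} (y + Z \<omega>)))"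
    unfolding J by (intro Bochner_Integration.integral_cong) (auto simp: indicator_def algebra_simps)
  also have "\<dots> = expectation (\<lambda>\<omega>. LINT y|M. indicator {..x} (y + Z \<omega>))"
    by (intro MP.Fubini_integral[symmetric] MP.integrable_const_bound[of _ 1])
      (auto simp: indicator_def split_beta')
  also have "\<dots> = displaced F x"
    unfolding displaced_def
  proof (intro Bochner_Integration.integral_cong refl)
    fix \<omega>
    have "(LINT y|M. indicator {..x} (y + Z \<omega>)) = (LINT y|M. indicator {..x - Z \<omega>} y :: real)"
      by (intro Bochner_Integration.integral_cong) (auto simp: indicator_def)
    then show "(LINT y|M. indicator {..x} (y + Z \<omega>)) = F (x - Z \<omega>)" by (simp add: FM cdf_def)
  qed
  finally show ?thesis by (simp add: FM interval_measure_cdf[OF M])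
qed

text \<open>The right-hand side is continuous in time because averaging over \<open>Z\<close> preserves the Lipschitz bound that holds
uniformly in space.\<close>

lemma mfl_evolution:
  assumes "0 < lam" and f: "is_mfl lam (cdf (distr P borel Z)) f" and "0 < t"
  shows "((\<lambda>s. f s x) has_real_derivative
            lam * (displaced (f t) x - f t x) - f t x * (1 - f t x)) (at t)"
proof (rule derivative_everywhere_of_where_differentiable[where L = "lam + 1"
      and g = "\<lambda>t. lam * (displaced (f t) x - f t x) - f t x * (1 - f t x)"])
  have cdf: "f t \<in> proper_cdfs" if "0 \<le> t" for t using f that by (simp add: is_mfl_def)
  show "antimono_on {0..} (\<lambda>s. f s x)" using f by (simp add: is_mfl_def)
  have lip: "(lam + 1)-lipschitz_on {0..} (\<lambda>s. f s x)" for x using f by (simp add: is_mfl_def)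
  show "(lam + 1)-lipschitz_on {0..} (\<lambda>s. f s x)" by (rule lip)
  have "(lam + 1)-lipschitz_on {0..} (\<lambda>t. displaced (f t) x)"
  proof (rule lipschitz_onI)
    fix s t :: real assume st: "s \<in> {0..}" "t \<in> {0..}"
    have int: "integrable P (\<lambda>\<omega>. f s (x - Z \<omega>))" "integrable P (\<lambda>\<omega>. f t (x - Z \<omega>))"
      using st by (auto intro!: integrable_cdf_displaced cdf)
    have "\<bar>displaced (f s) x - displaced (f t) x\<bar> = \<bar>expectation (\<lambda>\<omega>. f s (x - Z \<omega>) - f t (x - Z \<omega>))\<bar>"
      unfolding displaced_def using int by simp
    also have "\<dots> \<le> expectation (\<lambda>\<omega>. \<bar>f s (x - Z \<omega>) - f t (x - Z \<omega>)\<bar>)"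
      by (rule integral_abs_bound)
    also have "\<dots> \<le> expectation (\<lambda>_. (lam + 1) * \<bar>s - t\<bar>)"
      using int lipschitz_onD[OF lip st] by (intro integral_mono) (auto simp: dist_real_def)
    also have "\<dots> = (lam + 1) * \<bar>s - t\<bar>" by (simp add: prob_space)
    finally show "dist (displaced (f s) x) (displaced (f t) x) \<le> (lam + 1) * dist s t"
      by (simp add: dist_real_def)
  qed (use \<open>0 < lam\<close> in simp)
  then have "continuous_on {0..} (\<lambda>t. displaced (f t) x)" by (rule lipschitz_on_continuous_on)
  moreover have "continuous_on {0..} (\<lambda>t. f t x)" by (rule lipschitz_on_continuous_on[OF lip])
  ultimately show "continuous_on {0..} (\<lambda>t. lam * (displaced (f t) x - f t x) - f t x * (1 - f t x))"
    by (intro continuous_intros)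
  show "((\<lambda>s. f s x) has_real_derivative lam * (displaced (f t) x - f t x) - f t x * (1 - f t x))
      (at t within {0..})" if "0 \<le> t" "(\<lambda>s. f s x) differentiable at t within {0..}" for t
  proof -
    have "((\<lambda>s. f s x) has_real_derivative
        - lam * (LINT y:{..x}|interval_measure (f t). 1 - cdf (distr P borel Z) (x - y))
        - f t x * (1 - f t x)) (at t within {0..})"
      using f that unfolding is_mfl_def by blast
    then show ?thesis unfolding crossing_rate_eq[OF cdf[OF that(1)]]
      by (rule DERIV_cong) (simp add: algebra_simps)
  qed
qed fact

end

section \<open>Exponential moments of the capped jump\<close>

context positive_jump begin

definition capped_mgf :: "real \<Rightarrow> real \<Rightarrow> real" where
  "capped_mgf b \<zeta> = expectation (\<lambda>\<omega>. exp (\<zeta> * min (Z \<omega>) b))"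

text \<open>The derivative of \<open>capped_mgf\<close> in \<open>\<zeta>\<close>.\<close>

definition capped_tilted_mean :: "real \<Rightarrow> real \<Rightarrow> real" where
  "capped_tilted_mean b \<zeta> = expectation (\<lambda>\<omega>. exp (\<zeta> * min (Z \<omega>) b) * min (Z \<omega>) b)"

definition capped_speed :: "real \<Rightarrow> real \<Rightarrow> real \<Rightarrow> real" where
  "capped_speed lam b \<zeta> = (lam * capped_mgf b \<zeta> - lam + 1) / \<zeta>"

lemma AE_capped:
  assumes "0 \<le> b"
  shows "AE \<omega> in P. 0 \<le> min (Z \<omega>) b \<and> min (Z \<omega>) b \<le> b"
  using Z_pos assms by (auto elim!: eventually_mono)

lemma integrable_capped:
  fixes g :: "real \<Rightarrow> real"
  assumes "0 \<le> b" and [measurable]: "g \<in> borel_measurable borel" and "\<And>z. 0 \<le> z \<Longrightarrow> z \<le> b \<Longrightarrow> \<bar>g z\<bar> \<le> K"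
  shows "integrable P (\<lambda>\<omega>. g (min (Z \<omega>) b))"
  using AE_capped[OF assms(1)] assms(3)
  by (intro integrable_const_bound[of _ K]) (auto elim!: eventually_mono)

lemma expectation_capped_mono:
  fixes g h :: "real \<Rightarrow> real"
  assumes "0 \<le> b" "integrable P (\<lambda>\<omega>. g (min (Z \<omega>) b))" "integrable P (\<lambda>\<omega>. h (min (Z \<omega>) b))"
    and le: "\<And>z. 0 \<le> z \<Longrightarrow> z \<le> b \<Longrightarrow> g z \<le> h z"
  shows "expectation (\<lambda>\<omega>. g (min (Z \<omega>) b)) \<le> expectation (\<lambda>\<omega>. h (min (Z \<omega>) b))"
  using AE_capped[OF assms(1)] le
  by (intro integral_mono_AE assms) (auto elim!: eventually_mono)

lemma exp_capped_le:
  fixes z :: real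
  assumes "0 \<le> z" "z \<le> b" 
  shows "exp (\<zeta> * z) \<le> exp (\<bar>\<zeta>\<bar> * b)"
proof -
  have "\<zeta> * z \<le> \<bar>\<zeta>\<bar> * z" using assms by (intro mult_right_mono) auto
  also have "\<dots> \<le> \<bar>\<zeta>\<bar> * b" using assms by (intro mult_left_mono) auto
  finally show ?thesis by simp
qed

lemma integrable_capped_exp:
  assumes "0 \<le> b"
  shows "integrable P (\<lambda>\<omega>. exp (\<zeta> * min (Z \<omega>) b))"
  by (rule integrable_capped[OF assms, of "\<lambda>z. exp (\<zeta> * z)" "exp (\<bar>\<zeta>\<bar> * b)"])
    (auto intro: exp_capped_le[unfolded exp_le_cancel_iff])

lemma integrable_capped_tilted:
  fixes g :: "real \<Rightarrow> real"
  assumes "0 \<le> b" and [measurable]: "g \<in> borel_measurable borel" and g: "\<And>z. 0 \<le> z \<Longrightarrow> z \<le> b \<Longrightarrow> \<bar>g z\<bar> \<le> K"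
  shows "integrable P (\<lambda>\<omega>. exp (\<zeta> * min (Z \<omega>) b) * g (min (Z \<omega>) b))"
proof (rule integrable_capped[OF assms(1), of "\<lambda>z. exp (\<zeta> * z) * g z" "exp (\<bar>\<zeta>\<bar> * b) * K"])
  show "\<bar>exp (\<zeta> * z) * g z\<bar> \<le> exp (\<bar>\<zeta>\<bar> * b) * K" if "0 \<le> z" "z \<le> b" for z
    unfolding abs_mult abs_exp_cancel using that by (intro mult_mono exp_capped_le g) auto
qed measurable

lemma capped_mgf_ge_1:
  assumes "0 \<le> b" "0 \<le> \<zeta>"
  shows "1 \<le> capped_mgf b \<zeta>"
proof -
  have "expectation (\<lambda>_. 1) \<le> capped_mgf b \<zeta>" unfolding capped_mgf_def
    using assms integrable_capped_exp[OF assms(1)]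
    by (intro expectation_capped_mono[of b "\<lambda>_. 1"]) auto
  then show ?thesis by (simp add: prob_space)
qed

lemma capped_mgf_mono:
  assumes "0 \<le> b" "b \<le> b'" "0 \<le> \<zeta>"
  shows "capped_mgf b \<zeta> \<le> capped_mgf b' \<zeta>"
  unfolding capped_mgf_def using assms
  by (intro integral_mono integrable_capped_exp) (auto intro!: mult_left_mono)

text \<open>Convexity of the moment generating function: the graph lies above its tangents.\<close>

lemma capped_mgf_increment:
  assumes b: "0 \<le> b"
  shows "capped_mgf b \<zeta> + (\<xi> - \<zeta>) * capped_tilted_mean b \<zeta> \<le> capped_mgf b \<xi>"
proof -
  have int: "integrable P (\<lambda>\<omega>. exp (\<zeta> * min (Z \<omega>) b) * min (Z \<omega>) b)"
    by (rule integrable_capped_tilted[OF b, of "\<lambda>z. z" b]) auto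
  have "expectation (\<lambda>\<omega>. exp (\<zeta> * min (Z \<omega>) b) + (\<xi> - \<zeta>) * (exp (\<zeta> * min (Z \<omega>) b) * min (Z \<omega>) b))
      \<le> capped_mgf b \<xi>" unfolding capped_mgf_def
  proof (intro integral_mono integrable_capped_exp b Bochner_Integration.integrable_add integrable_mult_right int)
    fix \<omega>
    let ?z = "min (Z \<omega>) b"
    have "exp (\<zeta> * ?z) * (1 + (\<xi> - \<zeta>) * ?z) \<le> exp (\<zeta> * ?z) * exp ((\<xi> - \<zeta>) * ?z)"
      by (intro mult_left_mono exp_ge_add_one_self) auto
    then show "exp (\<zeta> * ?z) + (\<xi> - \<zeta>) * (exp (\<zeta> * ?z) * ?z) \<le> exp (\<xi> * ?z)"
      by (simp add: algebra_simps flip: exp_add)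
  qed
  then show ?thesis
    using int integrable_capped_exp[OF b] by (simp add: capped_mgf_def capped_tilted_mean_def)
qed

lemma capped_tilted_mean_increment:
  assumes b: "0 \<le> b" and "0 \<le> \<zeta>" "\<zeta> \<le> \<xi>" 
  shows "capped_tilted_mean b \<xi> \<le> capped_tilted_mean b \<zeta> + (\<xi> - \<zeta>) * (exp (\<xi> * b) * b\<^sup>2)"
proof -
  have int: "integrable P (\<lambda>\<omega>. exp (\<zeta> * min (Z \<omega>) b) * min (Z \<omega>) b)" for \<zeta>
    by (rule integrable_capped_tilted[OF b, of "\<lambda>z. z" b]) auto
  have "capped_tilted_mean b \<xi> \<le>
      expectation (\<lambda>\<omega>. exp (\<zeta> * min (Z \<omega>) b) * min (Z \<omega>) b + (\<xi> - \<zeta>) * (exp (\<xi> * b) * b\<^sup>2))"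
    unfolding capped_tilted_mean_def
  proof (rule expectation_capped_mono[OF b, of "\<lambda>z. exp (\<xi> * z) * z"
        "\<lambda>z. exp (\<zeta> * z) * z + (\<xi> - \<zeta>) * (exp (\<xi> * b) * b\<^sup>2)"])
    fix z assume z: "0 \<le> z" "z \<le> b"
    have "exp (\<xi> * z) * (1 + (\<zeta> - \<xi>) * z) \<le> exp (\<xi> * z) * exp ((\<zeta> - \<xi>) * z)"
      by (intro mult_left_mono exp_ge_add_one_self) auto
    then have "exp (\<xi> * z) \<le> exp (\<zeta> * z) + (\<xi> - \<zeta>) * (exp (\<xi> * z) * z)"
      by (simp add: algebra_simps flip: exp_add)
    then have "exp (\<xi> * z) * z \<le> (exp (\<zeta> * z) + (\<xi> - \<zeta>) * (exp (\<xi> * z) * z)) * z"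
      using z by (intro mult_right_mono)
    also have "\<dots> = exp (\<zeta> * z) * z + (\<xi> - \<zeta>) * (exp (\<xi> * z) * z\<^sup>2)"
      by (simp add: algebra_simps power2_eq_square)
    also have "\<dots> \<le> exp (\<zeta> * z) * z + (\<xi> - \<zeta>) * (exp (\<xi> * b) * b\<^sup>2)"
      using z assms by (intro add_left_mono mult_left_mono mult_mono power_mono) (auto intro: mult_left_mono)
    finally show "exp (\<xi> * z) * z \<le> exp (\<zeta> * z) * z + (\<xi> - \<zeta>) * (exp (\<xi> * b) * b\<^sup>2)" .
  qed (use int in auto)
  then show ?thesis using int by (simp add: capped_tilted_mean_def prob_space)
qed

lemma capped_mgf_continuous:
  assumes b: "0 \<le> b"
  shows "continuous_on {0..R} (capped_mgf b)"
proof -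
  define K where "K = exp (R * b) * b"
  have int: "integrable P (\<lambda>\<omega>. exp (\<zeta> * min (Z \<omega>) b) * min (Z \<omega>) b)" for \<zeta>
    by (rule integrable_capped_tilted[OF b, of "\<lambda>z. z" b]) auto
  have tilted: "\<bar>capped_tilted_mean b \<zeta>\<bar> \<le> K" if "\<zeta> \<in> {0..R}" for \<zeta>
  proof -
    have "capped_tilted_mean b \<zeta> \<le> expectation (\<lambda>_. K)" unfolding capped_tilted_mean_def K_def
      using int that b
      by (intro expectation_capped_mono[of b "\<lambda>z. exp (\<zeta> * z) * z" "\<lambda>_. exp (R * b) * b"])
        (auto intro!: mult_mono)
    moreover have "expectation (\<lambda>_. 0) \<le> capped_tilted_mean b \<zeta>" unfolding capped_tilted_mean_def
      using int that b by (intro expectation_capped_mono[of b "\<lambda>_. 0" "\<lambda>z. exp (\<zeta> * z) * z"]) auto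
    ultimately show ?thesis by (simp add: prob_space)
  qed
  have "K-lipschitz_on {0..R} (capped_mgf b)"
  proof (rule lipschitz_onI)
    show "0 \<le> K" using b by (simp add: K_def)
    fix \<zeta> \<xi> assume z: "\<zeta> \<in> {0..R}" "\<xi> \<in> {0..R}"
    have step: "capped_mgf b \<zeta> - capped_mgf b \<xi> \<le> K * \<bar>\<zeta> - \<xi>\<bar>" if "\<zeta> \<in> {0..R}" for \<zeta> \<xi>
    proof -
      have "capped_mgf b \<zeta> - capped_mgf b \<xi> \<le> capped_tilted_mean b \<zeta> * (\<zeta> - \<xi>)"
        using capped_mgf_increment[OF b, of \<zeta> \<xi>] by (simp add: algebra_simps)
      also have "\<dots> \<le> \<bar>capped_tilted_mean b \<zeta>\<bar> * \<bar>\<zeta> - \<xi>\<bar>" by (metis abs_ge_self abs_mult)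
      also have "\<dots> \<le> K * \<bar>\<zeta> - \<xi>\<bar>" using tilted[OF that] by (intro mult_right_mono) auto
      finally show ?thesis .
    qed
    show "dist (capped_mgf b \<zeta>) (capped_mgf b \<xi>) \<le> K * dist \<zeta> \<xi>"
      using step[OF z(1), of \<xi>] step[OF z(2), of \<zeta>] by (simp add: dist_real_def abs_minus_commute abs_le_iff)
  qed
  then show ?thesis by (rule lipschitz_on_continuous_on)
qed

text \<open>The quadratic term of the exponential series.  It makes the capped speed tend to infinity with \<open>\<zeta>\<close>,
so that minimisation over \<open>\<zeta>\<close> takes place on a compact set.\<close>

lemma capped_mgf_quadratic_growth:
  assumes "0 < b"
  obtains q where "0 < q" "\<And>\<zeta>. 0 \<le> \<zeta> \<Longrightarrow> 1 + q * \<zeta>\<^sup>2 \<le> capped_mgf b \<zeta>"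
proof
  let ?q = "expectation (\<lambda>\<omega>. (min (Z \<omega>) b)\<^sup>2) / 2"
  have int: "integrable P (\<lambda>\<omega>. (min (Z \<omega>) b)\<^sup>2)"
    using assms by (intro integrable_capped[of b "\<lambda>z. z\<^sup>2" "b\<^sup>2"]) (auto intro: power_mono)
  have "expectation (\<lambda>\<omega>. (min (Z \<omega>) b)\<^sup>2) \<noteq> 0"
  proof
    assume "expectation (\<lambda>\<omega>. (min (Z \<omega>) b)\<^sup>2) = 0"
    then have "AE \<omega> in P. (min (Z \<omega>) b)\<^sup>2 = 0"
      using integral_nonneg_eq_0_iff_AE[OF int] by simp
    with Z_pos have "AE \<omega> in P. False"
      by eventually_elim (use assms in \<open>auto simp: min_def split: if_splits\<close>)
    then show False by simp
  qed
  moreover have "0 \<le> expectation (\<lambda>\<omega>. (min (Z \<omega>) b)\<^sup>2)" by (intro integral_nonneg_AE) auto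
  ultimately show "0 < ?q" by linarith
  fix \<zeta> :: real assume \<zeta>: "0 \<le> \<zeta>"
  have "expectation (\<lambda>\<omega>. 1 + \<zeta>\<^sup>2 / 2 * (min (Z \<omega>) b)\<^sup>2) \<le> capped_mgf b \<zeta>" unfolding capped_mgf_def
  proof (rule expectation_capped_mono[of b "\<lambda>z. 1 + \<zeta>\<^sup>2 / 2 * z\<^sup>2" "\<lambda>z. exp (\<zeta> * z)"])
    fix z :: real assume "0 \<le> z"
    then show "1 + \<zeta>\<^sup>2 / 2 * z\<^sup>2 \<le> exp (\<zeta> * z)"
      using exp_lower_Taylor_quadratic[of "\<zeta> * z"] \<zeta> mult_nonneg_nonneg[of \<zeta> z]
      unfolding power_mult_distrib by linarith
  qed (use assms int integrable_capped_exp in auto)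
  then show "1 + ?q * \<zeta>\<^sup>2 \<le> capped_mgf b \<zeta>"
    using int by (simp add: prob_space mult.commute)
qed

text \<open>Write \<open>\<Lambda> \<zeta> = lam * capped_mgf b \<zeta> - lam + 1\<close>.  Below the critical speed, \<open>\<Lambda> \<zeta> - V * \<zeta>\<close> is positive; let \<open>a\<close> be its
minimiser on the nonnegative reals.  If \<open>a > 0\<close> then \<open>\<Lambda>' a = V\<close>, and \<open>\<Lambda> a - a * \<Lambda>' a\<close> is the positive minimum.  If
\<open>a = 0\<close> then \<open>\<Lambda>' 0 \<ge> V\<close>, and \<open>\<Lambda> 0 = 1\<close>.  The conditions on \<open>\<Lambda>' a\<close> are obtained by letting \<open>h\<close> tend to 0 in the
tangent inequality at \<open>a + h\<close> and \<open>a - h\<close>.\<close>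

lemma subcritical_tilt:
  assumes lam: "0 < lam" and b: "0 < b" and sub: "\<And>\<zeta>. 0 < \<zeta> \<Longrightarrow> V < capped_speed lam b \<zeta>"
  obtains a where "0 \<le> a" "V \<le> lam * capped_tilted_mean b a"
    "0 < lam * capped_mgf b a - lam + 1 - a * (lam * capped_tilted_mean b a)"
proof -
  define \<Psi> where "\<Psi> \<zeta> = lam * capped_mgf b \<zeta> - lam + 1 - V * \<zeta>" for \<zeta>
  have \<Psi>0: "\<Psi> 0 = 1" by (simp add: \<Psi>_def capped_mgf_def prob_space)
  have \<Psi>pos: "0 < \<Psi> \<zeta>" if "0 \<le> \<zeta>" for \<zeta>
    using sub[of \<zeta>] that \<Psi>0 by (cases "\<zeta> = 0") (auto simp: \<Psi>_def capped_speed_def field_simps)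
  obtain q where q: "0 < q" "\<And>\<zeta>. 0 \<le> \<zeta> \<Longrightarrow> 1 + q * \<zeta>\<^sup>2 \<le> capped_mgf b \<zeta>"
    using capped_mgf_quadratic_growth[OF b] by blast
  define R where "R = \<bar>V\<bar> / (lam * q)"
  have R: "0 \<le> R" using lam q by (simp add: R_def)
  have large: "1 \<le> \<Psi> \<zeta>" if "R \<le> \<zeta>" for \<zeta>
  proof -
    have "0 \<le> \<zeta>" using that R by simp
    have "V \<le> lam * q * \<zeta>" using that lam q by (simp add: R_def divide_le_eq mult.commute)
    then have "V * \<zeta> \<le> lam * q * \<zeta> * \<zeta>" using \<open>0 \<le> \<zeta>\<close> by (intro mult_right_mono)
    moreover have "lam * (1 + q * \<zeta>\<^sup>2) \<le> lam * capped_mgf b \<zeta>" using q(2)[OF \<open>0 \<le> \<zeta>\<close>] lam by simp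
    ultimately show ?thesis by (simp add: \<Psi>_def power2_eq_square algebra_simps)
  qed
  have "continuous_on {0..R} \<Psi>" unfolding \<Psi>_def using b
    by (intro continuous_intros capped_mgf_continuous) auto
  then obtain a where a: "a \<in> {0..R}" "\<And>\<zeta>. \<zeta> \<in> {0..R} \<Longrightarrow> \<Psi> a \<le> \<Psi> \<zeta>"
    using continuous_attains_inf[of "{0..R}" \<Psi>] R by auto
  have min: "\<Psi> a \<le> \<Psi> \<zeta>" if "0 \<le> \<zeta>" for \<zeta>
  proof (cases "\<zeta> \<le> R")
    case True
    then show ?thesis using a(2) that by auto
  next
    case False
    then show ?thesis using large[of \<zeta>] a(2)[of 0] R \<Psi>0 by auto
  qed
  define d where "d = capped_tilted_mean b a"
  have "0 \<le> a" using a by simp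
  have slope: "(\<xi> - a) * V \<le> (\<xi> - a) * (lam * capped_tilted_mean b \<xi>)" if "0 \<le> \<xi>" for \<xi>
  proof -
    have "(\<xi> - a) * V \<le> lam * (capped_mgf b \<xi> - capped_mgf b a)"
      using min[OF that] by (simp add: \<Psi>_def algebra_simps)
    also have "\<dots> \<le> lam * ((\<xi> - a) * capped_tilted_mean b \<xi>)"
      using capped_mgf_increment[of b \<xi> a] b lam by (intro mult_left_mono) (auto simp: algebra_simps)
    finally show ?thesis by (simp add: algebra_simps)
  qed
  define K where "K = lam * (exp ((a + 1) * b) * b\<^sup>2)"
  have "0 \<le> K" using lam by (simp add: K_def)
  have Kbound: "lam * (h * (exp (x * b) * b\<^sup>2)) \<le> h * K" if "0 \<le> h" "x \<le> a + 1" for h x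
  proof -
    have "exp (x * b) \<le> exp ((a + 1) * b)" using that b by simp
    then have "lam * h * (exp (x * b) * b\<^sup>2) \<le> lam * h * (exp ((a + 1) * b) * b\<^sup>2)"
      using that lam by (intro mult_left_mono mult_right_mono) auto
    then show ?thesis by (simp add: K_def algebra_simps)
  qed
  have arbitrarily_small: "x \<le> y" if "\<And>h. 0 < h \<Longrightarrow> h \<le> h0 \<Longrightarrow> x \<le> y + h * K" "0 < h0" for x y h0 :: real
  proof (rule field_le_epsilon)
    fix e :: real assume "0 < e"
    define h where "h = min h0 (e / (K + 1))"
    have "h * K \<le> e / (K + 1) * K" using \<open>0 \<le> K\<close> by (intro mult_right_mono) (auto simp: h_def)
    also have "\<dots> \<le> e" using \<open>0 \<le> K\<close> \<open>0 < e\<close> by (simp add: field_simps)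
    finally show "x \<le> y + e"
      using that(1)[of h] that(2) \<open>0 < e\<close> \<open>0 \<le> K\<close> by (force simp: h_def)
  qed
  have "V \<le> lam * d"
  proof (rule arbitrarily_small)
    fix h :: real assume h: "0 < h" "h \<le> 1"
    have "V \<le> lam * capped_tilted_mean b (a + h)" using slope[of "a + h"] h \<open>0 \<le> a\<close> by simp
    also have "\<dots> \<le> lam * (d + h * (exp ((a + h) * b) * b\<^sup>2))"
      using capped_tilted_mean_increment[of b a "a + h"] h b lam \<open>0 \<le> a\<close> by (simp add: d_def)
    also have "\<dots> \<le> lam * d + h * K" using Kbound[of h "a + h"] h by (simp add: distrib_left)
    finally show "V \<le> lam * d + h * K" .
  qed simp
  moreover have "a * (lam * d) \<le> a * V"
  proof (cases "a = 0")
    case False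
    have "lam * d \<le> V"
    proof (rule arbitrarily_small)
      fix h :: real assume h: "0 < h" "h \<le> a"
      have "lam * d \<le> lam * (capped_tilted_mean b (a - h) + h * (exp (a * b) * b\<^sup>2))"
        using capped_tilted_mean_increment[of b "a - h" a] h b lam by (simp add: d_def)
      also have "\<dots> \<le> lam * capped_tilted_mean b (a - h) + h * K"
        using Kbound[of h a] h by (simp add: distrib_left)
      also have "lam * capped_tilted_mean b (a - h) \<le> V" using slope[of "a - h"] h by simp
      finally show "lam * d \<le> V + h * K" by simp
    qed (use False \<open>0 \<le> a\<close> in simp)
    then show ?thesis using \<open>0 \<le> a\<close> by (intro mult_left_mono)
  qed simp
  ultimately show thesis
    using that[of a] \<open>0 \<le> a\<close> \<Psi>pos[OF \<open>0 \<le> a\<close>] by (simp add: \<Psi>_def d_def mult.commute)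
qed

text \<open>For a hump with exponents \<open>a\<close> and \<open>k\<close> the sine terms of the linear equation must cancel, which forces the equation for
\<open>V\<close>; the cosine terms must leave a gain \<open>\<epsilon>\<close> to pay for the quadratic term.  As \<open>k\<close> tends to 0, the equation for \<open>V\<close> becomes
\<open>V = \<Lambda>' a\<close> and the gain becomes \<open>\<Lambda> a - a * \<Lambda>' a\<close>, in the notation of the previous lemma, so both
requirements are met for small \<open>k\<close>.\<close>

lemma subcritical_hump_parameters:
  assumes lam: "0 < lam" and b: "0 < b" and sub: "\<And>\<zeta>. 0 < \<zeta> \<Longrightarrow> V\<^sub>1 < capped_speed lam b \<zeta>" and "V\<^sub>0 < V\<^sub>1"
  obtains a k \<epsilon> V where "0 \<le> a" "0 < k" "k * b \<le> pi" "0 < \<epsilon>" "\<epsilon> \<le> 1" "V\<^sub>0 < V"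
    "V * k = lam * expectation (\<lambda>\<omega>. exp (a * min (Z \<omega>) b) * sin (k * min (Z \<omega>) b))"
    "V * a + \<epsilon> \<le> lam * expectation (\<lambda>\<omega>. exp (a * min (Z \<omega>) b) * cos (k * min (Z \<omega>) b)) - lam + 1"
proof -
  obtain a where a: "0 \<le> a" "V\<^sub>1 \<le> lam * capped_tilted_mean b a"
    "0 < lam * capped_mgf b a - lam + 1 - a * (lam * capped_tilted_mean b a)"
    using subcritical_tilt[OF lam b sub] by blast
  define m where "m = capped_mgf b a"
  define d where "d = capped_tilted_mean b a"
  define H where "H = lam * m - lam + 1 - a * (lam * d)"
  have "0 < H" using a by (simp add: H_def m_def d_def)
  define M where "M = exp (a * b) * b\<^sup>2"
  have "0 < M" using b by (simp add: M_def)
  have "\<forall>\<^sub>F k in at_right 0. k * b < pi \<and> lam * (k * M) < V\<^sub>1 - V\<^sub>0 \<and> lam * (k\<^sup>2 * M) < H / 2"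
  proof (intro eventually_conj)
    have lims: "((\<lambda>k. k * b) \<longlongrightarrow> 0 * b) (at_right 0)" "((\<lambda>k. lam * (k * M)) \<longlongrightarrow> lam * (0 * M)) (at_right 0)"
      "((\<lambda>k. lam * (k\<^sup>2 * M)) \<longlongrightarrow> lam * (0\<^sup>2 * M)) (at_right 0)"
      by (intro tendsto_intros)+
    then show "\<forall>\<^sub>F k in at_right 0. k * b < pi" "\<forall>\<^sub>F k in at_right 0. lam * (k * M) < V\<^sub>1 - V\<^sub>0"
        "\<forall>\<^sub>F k in at_right 0. lam * (k\<^sup>2 * M) < H / 2"
      using order_tendstoD(2)[OF lims(1), of pi] order_tendstoD(2)[OF lims(2), of "V\<^sub>1 - V\<^sub>0"]
        order_tendstoD(2)[OF lims(3), of "H / 2"] \<open>V\<^sub>0 < V\<^sub>1\<close> \<open>0 < H\<close> by simp_all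
  qed
  then obtain k where k: "0 < k" "k * b < pi" "lam * (k * M) < V\<^sub>1 - V\<^sub>0" "lam * (k\<^sup>2 * M) < H / 2"
    using eventually_happens'[OF trivial_limit_at_right_real eventually_conj[OF eventually_at_right_less]] by blast
  define S where "S = expectation (\<lambda>\<omega>. exp (a * min (Z \<omega>) b) * sin (k * min (Z \<omega>) b))"
  define A where "A = expectation (\<lambda>\<omega>. exp (a * min (Z \<omega>) b) * cos (k * min (Z \<omega>) b))"
  have b0: "0 \<le> b" using b by simp
  have intd: "integrable P (\<lambda>\<omega>. exp (a * min (Z \<omega>) b) * min (Z \<omega>) b)"
    by (rule integrable_capped_tilted[OF b0, of "\<lambda>z. z" b]) auto
  have intS: "integrable P (\<lambda>\<omega>. exp (a * min (Z \<omega>) b) * sin (k * min (Z \<omega>) b))"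
    by (rule integrable_capped_tilted[OF b0, of "\<lambda>z. sin (k * z)" 1]) auto
  have intA: "integrable P (\<lambda>\<omega>. exp (a * min (Z \<omega>) b) * cos (k * min (Z \<omega>) b))"
    by (rule integrable_capped_tilted[OF b0, of "\<lambda>z. cos (k * z)" 1]) auto
  have tilt_bound: "exp (a * z) * z\<^sup>2 \<le> M" if "0 \<le> z" "z \<le> b" for z
    unfolding M_def using that a by (intro mult_mono power_mono) (auto intro: mult_left_mono)
  have S_upper: "S \<le> k * d"
  proof -
    have "S \<le> expectation (\<lambda>\<omega>. k * (exp (a * min (Z \<omega>) b) * min (Z \<omega>) b))"
      unfolding S_def using intS intd
    proof (intro expectation_capped_mono[OF b0, of "\<lambda>z. exp (a * z) * sin (k * z)" "\<lambda>z. k * (exp (a * z) * z)"])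
      fix z :: real assume "0 \<le> z"
      then have "exp (a * z) * sin (k * z) \<le> exp (a * z) * (k * z)"
        using k by (intro mult_left_mono sin_x_le_x) auto
      then show "exp (a * z) * sin (k * z) \<le> k * (exp (a * z) * z)" by (simp add: mult_ac)
    qed auto
    then show ?thesis using intd by (simp add: d_def capped_tilted_mean_def)
  qed
  have S_lower: "k * d - k\<^sup>2 * M \<le> S"
  proof -
    have "expectation (\<lambda>\<omega>. k * (exp (a * min (Z \<omega>) b) * min (Z \<omega>) b) - k\<^sup>2 * M) \<le> S"
      unfolding S_def using intS intd
    proof (intro expectation_capped_mono[OF b0, of "\<lambda>z. k * (exp (a * z) * z) - k\<^sup>2 * M" "\<lambda>z. exp (a * z) * sin (k * z)"])
      fix z :: real assume z: "0 \<le> z" "z \<le> b"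
      have "y - y\<^sup>2 \<le> sin y" for y :: real
      proof -
        have "\<bar>sin y - y\<bar> \<le> y\<^sup>2 / 2"
          using Maclaurin_sin_bound[of y 2] by (simp add: numeral_2_eq_2 sin_coeff_def)
        then show ?thesis unfolding abs_diff_le_iff using zero_le_power2[of y] by linarith
      qed
      then have "k * z - (k * z)\<^sup>2 \<le> sin (k * z)" .
      then have "exp (a * z) * (k * z - (k * z)\<^sup>2) \<le> exp (a * z) * sin (k * z)"
        by (intro mult_left_mono) auto
      moreover have "k\<^sup>2 * (exp (a * z) * z\<^sup>2) \<le> k\<^sup>2 * M" by (intro mult_left_mono tilt_bound z) auto
      ultimately show "k * (exp (a * z) * z) - k\<^sup>2 * M \<le> exp (a * z) * sin (k * z)"
        by (simp add: algebra_simps power_mult_distrib)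
    qed auto
    then show ?thesis using intd by (simp add: d_def capped_tilted_mean_def prob_space)
  qed
  have A_lower: "m - k\<^sup>2 * M \<le> A"
  proof -
    have "expectation (\<lambda>\<omega>. exp (a * min (Z \<omega>) b) - k\<^sup>2 * M) \<le> A"
      unfolding A_def using intA integrable_capped_exp[OF b0]
    proof (intro expectation_capped_mono[OF b0, of "\<lambda>z. exp (a * z) - k\<^sup>2 * M" "\<lambda>z. exp (a * z) * cos (k * z)"])
      fix z :: real assume z: "0 \<le> z" "z \<le> b"
      have "1 - y\<^sup>2 \<le> cos y" for y :: real
      proof -
        have "\<bar>sin (y / 2)\<bar>\<^sup>2 \<le> \<bar>y / 2\<bar>\<^sup>2" by (intro power_mono abs_sin_x_le_abs_x) auto
        then have "(sin (y / 2))\<^sup>2 \<le> y\<^sup>2 / 4" by (simp add: power_divide)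
        moreover have "cos y = 1 - 2 * (sin (y / 2))\<^sup>2" using cos_double_sin[of "y / 2"] by simp
        ultimately show ?thesis using zero_le_power2[of y] by linarith
      qed
      then have "1 - (k * z)\<^sup>2 \<le> cos (k * z)" .
      then have "exp (a * z) * (1 - (k * z)\<^sup>2) \<le> exp (a * z) * cos (k * z)"
        by (intro mult_left_mono) auto
      moreover have "k\<^sup>2 * (exp (a * z) * z\<^sup>2) \<le> k\<^sup>2 * M" by (intro mult_left_mono tilt_bound z) auto
      ultimately show "exp (a * z) - k\<^sup>2 * M \<le> exp (a * z) * cos (k * z)"
        by (simp add: algebra_simps power_mult_distrib)
    qed auto
    then show ?thesis using integrable_capped_exp[OF b0] by (simp add: m_def capped_mgf_def prob_space)
  qed
  define V where "V = lam * S / k"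
  have V_upper: "V \<le> lam * d"
    using mult_left_mono[OF S_upper, of lam] lam k by (simp add: V_def divide_le_eq mult_ac)
  have "V\<^sub>0 < lam * d - lam * (k * M)" using k(3) a(2) by (simp add: d_def)
  also have "\<dots> \<le> V"
    using mult_left_mono[OF S_lower, of lam] lam k
    by (simp add: V_def le_divide_eq power2_eq_square algebra_simps)
  finally have V_lower: "V\<^sub>0 < V" .
  define \<epsilon> where "\<epsilon> = min 1 (H / 2)"
  have "V * a \<le> lam * d * a" using V_upper a by (intro mult_right_mono)
  moreover have "lam * (m - k\<^sup>2 * M) \<le> lam * A" using A_lower lam by (intro mult_left_mono) auto
  moreover have "\<epsilon> \<le> H / 2" by (simp add: \<epsilon>_def)
  ultimately have "V * a + \<epsilon> \<le> lam * A - lam + 1"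
    using k(4) by (simp add: H_def algebra_simps)
  then show thesis
    using that[of a k \<epsilon> V] a k V_lower \<open>0 < H\<close>
    by (simp add: \<epsilon>_def V_def S_def A_def)
qed

end

section \<open>Barriers for the tail of the benchmark limit\<close>

text \<open>The positive part of \<open>exp (- a * y) * cos (k * y)\<close> with all humps but the central one removed.  Clamping the argument of the
cosine makes continuity immediate.\<close>

definition hump :: "real \<Rightarrow> real \<Rightarrow> real \<Rightarrow> real" where
  "hump a k y = exp (- a * y) * cos (max (- pi / 2) (min (pi / 2) (k * y)))"

lemma hump_nonneg: "0 \<le> hump a k y"
  unfolding hump_def using pi_gt_zero by (intro mult_nonneg_nonneg cos_ge_zero exp_ge_zero; linarith)

lemma hump_inside: "\<bar>k * y\<bar> < pi / 2 \<Longrightarrow> hump a k y = exp (- a * y) * cos (k * y)"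
  by (auto simp: hump_def abs_less_iff)

lemma hump_outside: "pi / 2 \<le> \<bar>k * y\<bar> \<Longrightarrow> hump a k y = 0"
proof -
  assume "pi / 2 \<le> \<bar>k * y\<bar>"
  then have "max (- pi / 2) (min (pi / 2) (k * y)) \<in> {pi / 2, - (pi / 2)}"
    using pi_gt_zero by (simp add: max_def min_def; linarith)
  moreover have "cos c = 0" if "c \<in> {pi / 2, - (pi / 2)}" for c :: real
    using that by (elim insertE emptyE) (simp_all only: cos_minus cos_pi_half)
  ultimately show ?thesis unfolding hump_def by (simp only: mult_zero_right)
qed

lemma hump_le:
  assumes "0 \<le> a" "0 < k"
  shows "hump a k y \<le> exp (a * (pi / (2 * k)))"
proof (cases "\<bar>k * y\<bar> < pi / 2")
  case True
  then have "- y \<le> pi / (2 * k)" using assms by (auto simp: abs_less_iff field_simps)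
  then have "a * - y \<le> a * (pi / (2 * k))" using assms by (intro mult_left_mono) auto
  then have "exp (- a * y) \<le> exp (a * (pi / (2 * k)))" by simp
  moreover have "exp (- a * y) * cos (k * y) \<le> exp (- a * y) * 1" by (intro mult_left_mono) auto
  ultimately show ?thesis unfolding hump_inside[OF True] by linarith
next
  case False
  then show ?thesis by (simp add: hump_outside)
qed

text \<open>A jump of length at most \<open>b\<close> reaches back from the central hump at most to the negative part of the cosine to its left,
never to the next positive part.  So cutting off the other humps does not spoil the
averages over jumps that enter the linear equation.\<close>

lemma hump_ge_oscillation:
  assumes "0 < k" "k * b \<le> pi" "\<bar>k * y\<bar> < pi / 2" "0 \<le> z" "z \<le> b"
  shows "exp (- a * (y - z)) * cos (k * (y - z)) \<le> hump a k (y - z)"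
proof (cases "\<bar>k * (y - z)\<bar> < pi / 2")
  case True
  then show ?thesis by (simp add: hump_inside)
next
  case False
  have "0 \<le> k * z" "k * z \<le> pi"
    using assms order_trans[OF mult_left_mono[of z b k] \<open>k * b \<le> pi\<close>] by simp_all
  then have "- (3 * pi / 2) < k * (y - z) \<and> k * (y - z) \<le> - (pi / 2)"
    using False assms(3) unfolding right_diff_distrib by linarith
  then have "0 \<le> cos (k * (y - z) + pi)" by (intro cos_ge_zero) auto
  then have "exp (- a * (y - z)) * cos (k * (y - z)) \<le> 0" by (simp add: mult_nonneg_nonpos)
  then show ?thesis using hump_nonneg by (rule order_trans)
qed

locale benchmark_mfl = positive_jump +
  fixes lam :: real and f :: "real \<Rightarrow> real \<Rightarrow> real"
  assumes lam_pos: "0 < lam" and bmfl: "is_bmfl lam (cdf (distr P borel Z)) f"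
begin

lemma f_cdf: "0 \<le> t \<Longrightarrow> f t \<in> proper_cdfs"
  and f_init: "f 0 x = (if 0 \<le> x then 1 else 0)"
  and f_antimono: "antimono_on {0..} (\<lambda>t. f t x)"
  and f_continuous: "continuous_on {0..} (\<lambda>t. f t x)"
  using bmfl lipschitz_on_continuous_on[of "lam + 1" "{0..}" "\<lambda>t. f t x"]
  by (auto simp: is_bmfl_def is_mfl_def indicator_def)

lemma tail_evolution:
  assumes "0 < t"
  shows "((\<lambda>s. 1 - f s x) has_real_derivative
     lam * ((1 - displaced (f t) x) - (1 - f t x)) + (1 - f t x) * (1 - (1 - f t x))) (at t)"
  using bmfl mfl_evolution[OF lam_pos _ assms, of f x]
  by (auto simp: is_bmfl_def algebra_simps intro!: derivative_eq_intros)

text \<open>The exponential solves the linearised equation exactly when \<open>\<zeta> * v\<close> has the given value, and the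
linearised equation dominates the equation of the tail because \<open>u * (1 - u) \<le> u\<close>.\<close>

lemma exponential_upper_barrier:
  assumes "0 < \<zeta>" and int: "integrable P (\<lambda>\<omega>. exp (\<zeta> * Z \<omega>))"
    and v: "lam * expectation (\<lambda>\<omega>. exp (\<zeta> * Z \<omega>)) - lam + 1 = \<zeta> * v"
    and "0 \<le> t"
  shows "1 - f t x \<le> exp (- \<zeta> * (x - v * t))"
proof -
  define w where "w t x = exp (- \<zeta> * (x - v * t))" for t x
  have "1 - f t x - w t x \<le> 0"
  proof (rule comparison_principle[where C = "lam + 1" and \<phi> = "\<lambda>t x. 1 - f t x - w t x"])
    fix t x :: real assume "0 \<le> t"
    note p = proper_cdfs_properties[OF f_cdf[OF this]]
    have "0 \<le> w t x" by (simp add: w_def)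
    then show "1 - f t x - w t x \<le> 1" using p(2)[of x] by linarith
  next
    fix x :: real
    show "1 - f 0 x - w 0 x \<le> 0"
      using \<open>0 < \<zeta>\<close> by (simp add: f_init w_def mult_nonneg_nonpos)
    show "continuous_on {0..} (\<lambda>t. 1 - f t x - w t x)"
      unfolding w_def by (intro continuous_intros f_continuous)
  next
    fix t x B :: real
    assume t: "0 < t" and pos: "0 < 1 - f t x - w t x" and B: "\<And>y. 1 - f t y - w t y \<le> B"
    let ?u = "1 - f t x" and ?w = "w t x" and ?E = "expectation (\<lambda>\<omega>. exp (\<zeta> * Z \<omega>))"
    let ?D = "lam * ((1 - displaced (f t) x) - ?u) + ?u * (1 - ?u) - \<zeta> * v * ?w"
    have "((\<lambda>s. w s x) has_real_derivative \<zeta> * v * ?w) (at t)"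
      unfolding w_def by (auto intro!: derivative_eq_intros)
    then have der: "((\<lambda>s. 1 - f s x - w s x) has_real_derivative ?D) (at t)"
      by (intro DERIV_diff tail_evolution t)
    have intf: "integrable P (\<lambda>\<omega>. f t (x - Z \<omega>))"
      using t by (intro integrable_cdf_displaced f_cdf) simp
    have wshift: "w t (x - z) = ?w * exp (\<zeta> * z)" for z
      by (simp add: w_def algebra_simps flip: exp_add)
    have "1 - f t (x - z) - ?w * exp (\<zeta> * z) \<le> B" for z
      using B[of "x - z"] by (simp only: wshift)
    then have "expectation (\<lambda>\<omega>. 1 - f t (x - Z \<omega>) - ?w * exp (\<zeta> * Z \<omega>)) \<le> expectation (\<lambda>_. B)"
      using intf int by (intro integral_mono) auto
    then have "1 - displaced (f t) x - ?w * ?E \<le> B"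
      using intf int by (simp add: displaced_def prob_space)
    then have 1: "lam * (1 - displaced (f t) x - ?w * ?E) \<le> lam * B"
      using lam_pos by simp
    have 2: "?u * (1 - ?u) \<le> ?u"
      using zero_le_square[of ?u] by (simp only: right_diff_distrib mult_1_right)
    have 3: "0 \<le> lam * (?u - ?w)" using lam_pos pos by simp
    have "?D = lam * (1 - displaced (f t) x - ?w * ?E) - lam * (?u - ?w) + ?u * (1 - ?u) - ?w"
      unfolding v[symmetric] by (simp add: algebra_simps)
    also have "\<dots> \<le> (lam + 1) * B"
      using 1 2 3 B[of x] by (simp add: distrib_right)
    finally show "\<exists>D\<le>(lam + 1) * B. ((\<lambda>s. 1 - f s x - w s x) has_real_derivative D) (at t)"
      using der by blast
  qed (use lam_pos \<open>0 \<le> t\<close> in auto)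
  then show ?thesis by (simp add: w_def)
qed

text \<open>The prefactor bounds the hump by \<open>\<epsilon>\<close>, so the quadratic term is at most \<open>\<epsilon>\<close> times the hump,
which the gain absorbs.  The shift by \<open>pi / (2 * k)\<close> places the hump at time 0 to the left of the origin, where the tail is 1.
Passing from \<open>Z\<close> to \<open>min Z b\<close> is allowed because the tail is nonincreasing in space.\<close>

lemma travelling_hump_lower_barrier:
  assumes a: "0 \<le> a" and k: "0 < k" and "0 < b" "k * b \<le> pi" and \<epsilon>: "0 < \<epsilon>" "\<epsilon> \<le> 1"
    and V: "V * k = lam * expectation (\<lambda>\<omega>. exp (a * min (Z \<omega>) b) * sin (k * min (Z \<omega>) b))"
    and gain: "V * a + \<epsilon> \<le> lam * expectation (\<lambda>\<omega>. exp (a * min (Z \<omega>) b) * cos (k * min (Z \<omega>) b)) - lam + 1"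
    and "0 \<le> t"
  shows "\<epsilon> * exp (- a * (pi / (2 * k))) * hump a k (x + pi / (2 * k) - V * t) \<le> 1 - f t x"
proof -
  define \<delta> where "\<delta> = \<epsilon> * exp (- a * (pi / (2 * k)))"
  define Y where "Y t x = x + pi / (2 * k) - V * t" for t x
  define w where "w t x = \<delta> * hump a k (Y t x)" for t x
  define A where "A = expectation (\<lambda>\<omega>. exp (a * min (Z \<omega>) b) * cos (k * min (Z \<omega>) b))"
  define S where "S = expectation (\<lambda>\<omega>. exp (a * min (Z \<omega>) b) * sin (k * min (Z \<omega>) b))"
  have \<delta>: "0 < \<delta>" using \<epsilon> by (simp add: \<delta>_def)
  have w_le: "w t x \<le> \<epsilon>" for t x
  proof -
    have "w t x \<le> \<delta> * exp (a * (pi / (2 * k)))"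
      unfolding w_def using \<delta> a k by (intro mult_left_mono hump_le) auto
    also have "\<dots> = \<epsilon>" by (simp add: \<delta>_def exp_minus)
    finally show ?thesis .
  qed
  have w_nonneg: "0 \<le> w t x" for t x using \<delta> hump_nonneg by (simp add: w_def)
  have bounded_exp: "exp (a * min z b) \<le> exp (a * b)" for z
    using a by (simp add: mult_left_mono)
  have intA: "integrable P (\<lambda>\<omega>. exp (a * min (Z \<omega>) b) * cos (k * min (Z \<omega>) b))"
    and intS: "integrable P (\<lambda>\<omega>. exp (a * min (Z \<omega>) b) * sin (k * min (Z \<omega>) b))"
    using mult_mono[OF bounded_exp abs_cos_le_one] mult_mono[OF bounded_exp abs_sin_le_one]
    by (auto intro!: integrable_const_bound[of _ "exp (a * b)"] simp: abs_mult)
  have "w t x - (1 - f t x) \<le> 0"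
  proof (rule comparison_principle[where C = "lam + 1" and \<phi> = "\<lambda>t x. w t x - (1 - f t x)"])
    fix t x :: real assume "0 \<le> t"
    note p = proper_cdfs_properties[OF f_cdf[OF this]]
    show "w t x - (1 - f t x) \<le> 1" using p(3)[of x] w_le[of t x] \<epsilon> by simp
  next
    fix x :: real
    show "w 0 x - (1 - f 0 x) \<le> 0"
    proof (cases "0 \<le> x")
      case True
      then have "pi / 2 \<le> \<bar>k * Y 0 x\<bar>" using k by (simp add: Y_def field_simps)
      then show ?thesis using True by (simp add: w_def hump_outside f_init)
    next
      case False
      then show ?thesis using w_le[of 0 x] \<epsilon> by (simp add: f_init)
    qed
    show "continuous_on {0..} (\<lambda>t. w t x - (1 - f t x))"
      unfolding w_def Y_def hump_def by (intro continuous_intros f_continuous)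
  next
    fix t x B :: real
    assume t: "0 < t" and pos: "0 < w t x - (1 - f t x)" and B: "\<And>y. w t y - (1 - f t y) \<le> B"
    note p = proper_cdfs_properties[OF f_cdf[OF less_imp_le[OF t]]]
    let ?u = "1 - f t x" and ?w = "w t x" and ?y = "Y t x"
    let ?e = "\<delta> * exp (- a * ?y)"
    have u: "0 \<le> ?u" using p(3)[of x] by simp
    have in_hump: "\<bar>k * ?y\<bar> < pi / 2"
      using pos u hump_outside[of k ?y a] by (force simp: w_def not_less)
    have w_eq: "?w = ?e * cos (k * ?y)" by (simp add: w_def hump_inside[OF in_hump])
    have der_w: "((\<lambda>s. w s x) has_real_derivative ?e * (V * a * cos (k * ?y) + V * k * sin (k * ?y))) (at t)"
    proof (rule has_field_derivative_transform_within_open)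
      have "continuous_on UNIV (\<lambda>s. \<bar>k * Y s x\<bar>)" unfolding Y_def by (intro continuous_intros)
      then show "open {s. \<bar>k * Y s x\<bar> < pi / 2}" by (intro open_Collect_less) auto
      show "((\<lambda>s. \<delta> * (exp (- a * Y s x) * cos (k * Y s x))) has_real_derivative
          ?e * (V * a * cos (k * ?y) + V * k * sin (k * ?y))) (at t)"
        unfolding Y_def by (auto intro!: derivative_eq_intros simp: algebra_simps)
    qed (use in_hump in \<open>auto simp: w_def hump_inside\<close>)
    let ?Dw = "?e * (V * a * cos (k * ?y) + V * k * sin (k * ?y))"
    let ?D = "?Dw - (lam * ((1 - displaced (f t) x) - ?u) + ?u * (1 - ?u))"
    have der: "((\<lambda>s. w s x - (1 - f s x)) has_real_derivative ?D) (at t)"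
      by (intro DERIV_diff tail_evolution t der_w)
    have intf: "integrable P (\<lambda>\<omega>. f t (x - Z \<omega>))"
      using t by (intro integrable_cdf_displaced f_cdf) simp
    let ?osc = "\<lambda>z. exp (a * z) * cos (k * z) * (?e * cos (k * ?y)) + exp (a * z) * sin (k * z) * (?e * sin (k * ?y))"
    \<comment> \<open>The addition theorem splits the shifted oscillation into cosine and sine parts at \<open>?y\<close>.\<close>
    have osc: "\<delta> * (exp (- a * (?y - z)) * cos (k * (?y - z))) = ?osc z" for z
      by (simp add: right_diff_distrib cos_diff algebra_simps flip: exp_add)
    have "AE \<omega> in P. ?osc (min (Z \<omega>) b) - B \<le> 1 - f t (x - Z \<omega>)"
      using Z_pos
    proof eventually_elim
      fix \<omega> assume "0 < Z \<omega>"
      let ?z = "min (Z \<omega>) b"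
      have "?osc ?z \<le> \<delta> * hump a k (?y - ?z)"
        unfolding osc[symmetric] using \<delta> \<open>0 < Z \<omega>\<close> assms(3,4) k in_hump
        by (intro mult_left_mono hump_ge_oscillation[of _ b]) auto
      also have "\<dots> = w t (x - ?z)" by (simp add: w_def Y_def algebra_simps)
      finally have "?osc ?z - B \<le> 1 - f t (x - ?z)" using B[of "x - ?z"] by linarith
      moreover have "f t (x - Z \<omega>) \<le> f t (x - ?z)" by (rule monoD[OF p(1)]) simp
      ultimately show "?osc ?z - B \<le> 1 - f t (x - Z \<omega>)" by linarith
    qed
    then have "expectation (\<lambda>\<omega>. ?osc (min (Z \<omega>) b) - B) \<le> expectation (\<lambda>\<omega>. 1 - f t (x - Z \<omega>))"
      using intf intA intS by (intro integral_mono_AE) auto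
    then have "A * ?w + S * (?e * sin (k * ?y)) - B \<le> 1 - displaced (f t) x"
      unfolding w_eq using intf intA intS by (simp add: A_def S_def displaced_def prob_space)
    then have 1: "lam * (A * ?w + S * (?e * sin (k * ?y)) - B) \<le> lam * (1 - displaced (f t) x)"
      using lam_pos by simp
    have "(V * a + \<epsilon>) * ?w \<le> (lam * A - lam + 1) * ?w"
      using gain w_nonneg by (intro mult_right_mono) (auto simp: A_def)
    moreover have "?w * ?w \<le> \<epsilon> * ?w" by (intro mult_right_mono w_le w_nonneg)
    moreover have "?Dw = V * a * ?w + lam * (S * (?e * sin (k * ?y)))"
      unfolding w_eq V[folded S_def] by (simp add: algebra_simps)
    ultimately have 2: "?Dw \<le> lam * (A * ?w + S * (?e * sin (k * ?y))) - lam * ?w + ?w - ?w * ?w"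
      by (simp only: distrib_left distrib_right left_diff_distrib mult_1_left mult.assoc)
    have 3: "0 \<le> lam * (?w - ?u)" using lam_pos pos by simp
    have 4: "?u * ?u \<le> ?w * ?w" using pos u by (intro mult_mono) auto
    have "?D \<le> (lam + 1) * B"
      using 1 2 3 4 B[of x] by (simp add: algebra_simps)
    then show "\<exists>D\<le>(lam + 1) * B. ((\<lambda>s. w s x - (1 - f s x)) has_real_derivative D) (at t)"
      using der by blast
  qed (use lam_pos \<open>0 \<le> t\<close> in auto)
  then show ?thesis by (simp add: w_def \<delta>_def Y_def)
qed

lemma displaced_le:
  assumes "0 \<le> t"
  shows "displaced (f t) x \<le> f t x"
proof -
  note p = proper_cdfs_properties[OF f_cdf[OF assms]]
  have "displaced (f t) x \<le> expectation (\<lambda>_. f t x)"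
    unfolding displaced_def using Z_pos
    by (intro integral_mono_AE integrable_cdf_displaced[OF f_cdf[OF assms]] integrable_const)
      (auto elim!: eventually_mono intro!: monoD[OF p(1)])
  then show ?thesis by (simp add: prob_space)
qed

text \<open>Since \<open>displaced (f t) x \<le> f t x\<close>, jumps only increase the tail \<open>u\<close> at a fixed place, whence
\<open>u' \<ge> u * (1 - u)\<close>.  While \<open>\<delta> \<le> u \<le> 1 - \<eta>\<close> this derivative is at least \<open>\<delta> * \<eta>\<close>, and \<open>u \<le> 1\<close> limits the
time during which that can last.\<close>

lemma logistic_growth:
  assumes "0 < \<delta>" "0 < \<eta>" "0 \<le> t\<^sub>0" "\<delta> \<le> 1 - f t\<^sub>0 x" "t\<^sub>0 + 1 / (\<delta> * \<eta>) \<le> t"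
  shows "f t x \<le> \<eta>"
proof (rule ccontr)
  assume neg: "\<not> f t x \<le> \<eta>"
  have pos: "0 < 1 / (\<delta> * \<eta>)" using assms by simp
  with assms have lt: "t\<^sub>0 < t" by linarith
  have anti: "f r x \<le> f s x" if "0 \<le> s" "s \<le> r" for s r
    using monotone_onD[OF f_antimono[of x], of s r] that by simp
  have cdf01: "0 \<le> f s x" "f s x \<le> 1" if "0 \<le> s" for s
    using proper_cdfs_properties(2,3)[OF f_cdf[OF that]] by auto
  define D where "D s = lam * ((1 - displaced (f s) x) - (1 - f s x)) + (1 - f s x) * (1 - (1 - f s x))" for s
  have "continuous_on {t\<^sub>0..t} (\<lambda>s. 1 - f s x)"
    using \<open>0 \<le> t\<^sub>0\<close> by (intro continuous_intros continuous_on_subset[OF f_continuous]) auto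
  moreover have "((\<lambda>s. 1 - f s x) has_derivative (*) (D s)) (at s)" if "t\<^sub>0 < s" "s < t" for s
    using tail_evolution[of s x] that \<open>0 \<le> t\<^sub>0\<close> by (simp add: D_def has_field_derivative_def)
  ultimately obtain \<xi> where \<xi>: "t\<^sub>0 < \<xi>" "\<xi> < t" "(1 - f t x) - (1 - f t\<^sub>0 x) = D \<xi> * (t - t\<^sub>0)"
    by (rule mvt[OF lt])
  have "\<delta> \<le> 1 - f \<xi> x" "\<eta> \<le> f \<xi> x"
    using anti[of t\<^sub>0 \<xi>] anti[of \<xi> t] \<xi> assms neg by auto
  then have "\<delta> * \<eta> \<le> (1 - f \<xi> x) * f \<xi> x"
    using assms cdf01[of \<xi>] \<xi> by (intro mult_mono) auto
  moreover have "0 \<le> lam * (f \<xi> x - displaced (f \<xi>) x)"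
    using displaced_le[of \<xi> x] \<xi> assms lam_pos by simp
  ultimately have "\<delta> * \<eta> \<le> D \<xi>" by (simp add: D_def algebra_simps)
  then have "1 / (\<delta> * \<eta>) * (\<delta> * \<eta>) \<le> (t - t\<^sub>0) * D \<xi>"
    using assms lt by (intro mult_mono) auto
  then have "1 \<le> (t - t\<^sub>0) * D \<xi>" using assms by simp
  with \<xi>(3) show False unfolding mult.commute[of "D \<xi>"] using assms(1,4) cdf01[of t] assms(3) lt by linarith
qed

end

section \<open>The critical speed as a limit of capped speeds\<close>

context positive_jump begin

lemma capped_speed_mono:
  assumes "0 < lam" "0 \<le> b" "b \<le> b'" "0 < \<zeta>"
  shows "capped_speed lam b \<zeta> \<le> capped_speed lam b' \<zeta>"
  using capped_mgf_mono[of b b' \<zeta>] assms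
  by (auto simp: capped_speed_def intro!: divide_right_mono mult_left_mono)

text \<open>For \<open>n \<ge> 1\<close> the admissible \<open>\<zeta>\<close> form nested compact sets: they stay away from 0 because the speed is at least
\<open>1 / \<zeta>\<close>, and bounded by the quadratic growth.  With constant \<open>c\<close> this shows that a speed below the critical one
is below all capped speeds for some cap; with \<open>c\<close> decreasing to the infimum it shows that the infimum is attained.\<close>

lemma capped_speed_compactness:
  fixes c :: "nat \<Rightarrow> real"
  assumes lam: "0 < lam" and c: "decseq c" and ex: "\<And>n. \<exists>\<zeta>>0. capped_speed lam (real n) \<zeta> \<le> c n"
  obtains \<zeta> where "0 < \<zeta>" "\<And>n. capped_speed lam (real n) \<zeta> \<le> c n"
proof -
  obtain q where q: "0 < q" "\<And>\<zeta>. 0 \<le> \<zeta> \<Longrightarrow> 1 + q * \<zeta>\<^sup>2 \<le> capped_mgf 1 \<zeta>"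
    using capped_mgf_quadratic_growth[of 1] by auto
  have bounds: "1 \<le> c 1 * \<zeta> \<and> \<zeta> \<le> c 1 / (lam * q)" if "0 < \<zeta>" "capped_speed lam (real (Suc n)) \<zeta> \<le> c (Suc n)" for \<zeta> n
  proof -
    have "capped_speed lam 1 \<zeta> \<le> capped_speed lam (real (Suc n)) \<zeta>"
      using lam that by (intro capped_speed_mono) auto
    also have "\<dots> \<le> c 1" using that decseqD[OF c, of 1 "Suc n"] by simp
    finally have "lam * capped_mgf 1 \<zeta> - lam + 1 \<le> c 1 * \<zeta>"
      using that(1) by (simp add: capped_speed_def divide_le_eq)
    moreover have "lam * (1 + q * \<zeta>\<^sup>2) \<le> lam * capped_mgf 1 \<zeta>"
      using lam q(2)[of \<zeta>] that by (intro mult_left_mono) auto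
    ultimately have *: "lam * q * \<zeta> * \<zeta> + 1 \<le> c 1 * \<zeta>"
      by (simp add: power2_eq_square algebra_simps)
    have "0 \<le> lam * q * \<zeta> * \<zeta>" using lam q(1) that(1) by simp
    with * have "1 \<le> c 1 * \<zeta>" by linarith
    moreover have "lam * q * \<zeta> * \<zeta> \<le> c 1 * \<zeta>" using * by linarith
    then have "\<zeta> \<le> c 1 / (lam * q)"
      using that(1) lam q(1) by (simp add: le_divide_eq mult.commute)
    ultimately show ?thesis by simp
  qed
  define R where "R = c 1 / (lam * q)"
  define S where "S n = {\<zeta> \<in> {0..R}. 1 \<le> c 1 * \<zeta> \<and> lam * capped_mgf (real (Suc n)) \<zeta> - lam + 1 \<le> c (Suc n) * \<zeta>}" for n
  have S_iff: "\<zeta> \<in> S n \<longleftrightarrow> 0 < \<zeta> \<and> capped_speed lam (real (Suc n)) \<zeta> \<le> c (Suc n)" for \<zeta> n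
  proof
    assume "\<zeta> \<in> S n"
    then have z: "0 \<le> \<zeta>" "1 \<le> c 1 * \<zeta>" "lam * capped_mgf (real (Suc n)) \<zeta> - lam + 1 \<le> c (Suc n) * \<zeta>"
      by (auto simp: S_def)
    then have "0 < \<zeta>" by (cases "\<zeta> = 0") auto
    with z show "0 < \<zeta> \<and> capped_speed lam (real (Suc n)) \<zeta> \<le> c (Suc n)"
      by (simp add: capped_speed_def divide_le_eq)
  next
    assume "0 < \<zeta> \<and> capped_speed lam (real (Suc n)) \<zeta> \<le> c (Suc n)"
    with bounds[of \<zeta> n] show "\<zeta> \<in> S n"
      by (auto simp: S_def R_def capped_speed_def divide_le_eq)
  qed
  have "\<Inter> (range S) \<noteq> {}"
  proof (rule compact_nest)
    fix n
    have cont: "continuous_on {0..R} (\<lambda>\<zeta>. lam * capped_mgf (real (Suc n)) \<zeta> - lam + 1 - c (Suc n) * \<zeta>)"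
      by (intro continuous_intros capped_mgf_continuous) auto
    have "closed ({0..R} \<inter> (\<lambda>\<zeta>. lam * capped_mgf (real (Suc n)) \<zeta> - lam + 1 - c (Suc n) * \<zeta>) -` {..0})"
      by (intro continuous_closed_preimage[OF cont]) auto
    moreover have "closed {\<zeta>. 1 \<le> c 1 * \<zeta>}" by (intro closed_Collect_le continuous_intros)
    ultimately have "closed ({0..R} \<inter> (\<lambda>\<zeta>. lam * capped_mgf (real (Suc n)) \<zeta> - lam + 1 - c (Suc n) * \<zeta>) -` {..0}
        \<inter> {\<zeta>. 1 \<le> c 1 * \<zeta>})" by (rule closed_Int)
    also have "\<dots> = S n" by (auto simp: S_def)
    finally have "closed (S n)" .
    moreover have "bounded (S n)" by (rule bounded_subset[of "{0..R}"]) (auto simp: S_def)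
    ultimately show "compact (S n)" by (simp add: compact_eq_bounded_closed)
    show "S n \<noteq> {}" using ex[of "Suc n"] S_iff[of _ n] by blast
    fix m assume "m \<le> n"
    show "S n \<subseteq> S m"
    proof
      fix \<zeta> assume z: "\<zeta> \<in> S n"
      then have "capped_speed lam (real (Suc m)) \<zeta> \<le> capped_speed lam (real (Suc n)) \<zeta>"
        using \<open>m \<le> n\<close> lam by (intro capped_speed_mono) (auto simp: S_iff)
      then show "\<zeta> \<in> S m"
        using z decseqD[OF c, of "Suc m" "Suc n"] \<open>m \<le> n\<close> unfolding S_iff by auto
    qed
  qed
  then obtain \<zeta> where "\<And>n. \<zeta> \<in> S n" by blast
  then have z: "0 < \<zeta>" "\<And>n. capped_speed lam (real (Suc n)) \<zeta> \<le> c (Suc n)" by (auto simp: S_iff)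
  have "capped_speed lam (real n) \<zeta> \<le> c n" for n
  proof (cases n)
    case 0
    have "capped_speed lam 0 \<zeta> \<le> capped_speed lam 1 \<zeta>" using lam z(1) by (intro capped_speed_mono) auto
    with z(2)[of 0] decseqD[OF c, of 0 1] 0 show ?thesis by simp
  next
    case (Suc m)
    then show ?thesis using z(2) by simp
  qed
  with z(1) show thesis by (rule that)
qed

lemma laplace_transform_cdf:
  "laplace_transform (cdf (distr P borel Z)) (- \<zeta>) = (\<integral>\<^sup>+\<omega>. ennreal (exp (\<zeta> * Z \<omega>)) \<partial>P)"
proof -
  have "interval_measure (cdf (distr P borel Z)) = distr P borel Z"
    by (intro interval_measure_cdf real_distribution_distr) simp
  then have "laplace_transform (cdf (distr P borel Z)) (- \<zeta>)
      = (\<integral>\<^sup>+\<omega>. ennreal (exp (\<zeta> * Z \<omega>)) * indicator {0..} (Z \<omega>) \<partial>P)"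
    unfolding laplace_transform_def by (simp add: nn_integral_distr)
  also have "\<dots> = (\<integral>\<^sup>+\<omega>. ennreal (exp (\<zeta> * Z \<omega>)) \<partial>P)"
    using Z_pos by (intro nn_integral_cong_AE) (auto elim!: eventually_mono)
  finally show ?thesis .
qed

text \<open>Monotone convergence as the cap grows; it also detects that the moment is infinite.\<close>

lemma exp_moment_le_iff:
  assumes "0 \<le> \<zeta>"
  shows "(\<integral>\<^sup>+\<omega>. ennreal (exp (\<zeta> * Z \<omega>)) \<partial>P) \<le> ennreal r \<longleftrightarrow> 0 \<le> r \<and> (\<forall>n. capped_mgf (real n) \<zeta> \<le> r)"
proof -
  have "(SUP n. ennreal (exp (\<zeta> * min z (real n)))) = ennreal (exp (\<zeta> * z))" for z
  proof (rule antisym)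
    show "(SUP n. ennreal (exp (\<zeta> * min z (real n)))) \<le> ennreal (exp (\<zeta> * z))"
      using assms by (intro SUP_least ennreal_leI) (auto intro!: mult_left_mono)
    obtain n :: nat where "z \<le> real n" using real_arch_simple by blast
    then show "ennreal (exp (\<zeta> * z)) \<le> (SUP n. ennreal (exp (\<zeta> * min z (real n))))"
      by (intro SUP_upper2[of n]) auto
  qed
  then have "(\<integral>\<^sup>+\<omega>. ennreal (exp (\<zeta> * Z \<omega>)) \<partial>P) = (\<integral>\<^sup>+\<omega>. (SUP n. ennreal (exp (\<zeta> * min (Z \<omega>) (real n)))) \<partial>P)"
    by simp
  also have "\<dots> = (SUP n. \<integral>\<^sup>+\<omega>. ennreal (exp (\<zeta> * min (Z \<omega>) (real n))) \<partial>P)"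
    using assms by (intro nn_integral_monotone_convergence_SUP)
      (auto simp: incseq_def le_fun_def intro!: ennreal_leI mult_left_mono)
  also have "(\<lambda>n. \<integral>\<^sup>+\<omega>. ennreal (exp (\<zeta> * min (Z \<omega>) (real n))) \<partial>P) = (\<lambda>n. ennreal (capped_mgf (real n) \<zeta>))"
    unfolding capped_mgf_def by (intro ext nn_integral_eq_integral integrable_capped_exp) auto
  finally have eq: "(\<integral>\<^sup>+\<omega>. ennreal (exp (\<zeta> * Z \<omega>)) \<partial>P) = (SUP n. ennreal (capped_mgf (real n) \<zeta>))" .
  have ge1: "1 \<le> capped_mgf (real n) \<zeta>" for n using assms by (intro capped_mgf_ge_1) auto
  have "ennreal (capped_mgf (real n) \<zeta>) \<le> ennreal r \<longleftrightarrow> capped_mgf (real n) \<zeta> \<le> r" for n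
    using ge1[of n] by (cases "0 \<le> r") (auto simp: ennreal_le_iff ennreal_neg)
  moreover have "0 \<le> r" if "\<forall>n. capped_mgf (real n) \<zeta> \<le> r"
    using ge1[of 0] that by (meson order_trans zero_le_one)
  ultimately show ?thesis unfolding eq SUP_le_iff by blast
qed

lemma speed_function_le_iff:
  assumes lam: "0 < lam" and z: "0 < \<zeta>"
  shows "speed_function lam (cdf (distr P borel Z)) \<zeta> \<le> ereal c \<longleftrightarrow> (\<forall>n. capped_speed lam (real n) \<zeta> \<le> c)"
proof -
  let ?X = "\<integral>\<^sup>+\<omega>. ennreal (exp (\<zeta> * Z \<omega>)) \<partial>P"
  define r where "r = (c * \<zeta> + lam - 1) / lam"
  have cap: "capped_speed lam (real n) \<zeta> \<le> c \<longleftrightarrow> capped_mgf (real n) \<zeta> \<le> r" for n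
    using lam z by (simp add: capped_speed_def r_def divide_le_eq le_divide_eq algebra_simps)
  have "1 \<le> capped_mgf (real 0) \<zeta>" using z by (intro capped_mgf_ge_1) auto
  then have "(\<forall>n. capped_speed lam (real n) \<zeta> \<le> c) \<longleftrightarrow> ?X \<le> ennreal r"
    unfolding cap exp_moment_le_iff[OF less_imp_le[OF z]] by (meson order_trans zero_le_one)
  moreover have "speed_function lam (cdf (distr P borel Z)) \<zeta> \<le> ereal c \<longleftrightarrow> ?X \<le> ennreal r"
  proof (cases ?X)
    case (real x)
    have "1 \<le> x"
    proof -
      have "(\<integral>\<^sup>+\<omega>. 1 \<partial>P) \<le> ennreal x"
        unfolding real(2)[symmetric] using z Z_pos
        by (intro nn_integral_mono_AE) (auto elim!: eventually_mono)
      then show ?thesis by (simp add: emeasure_space_1 ennreal_ge_1)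
    qed
    have "speed_function lam (cdf (distr P borel Z)) \<zeta> = ereal ((lam * x - lam + 1) / \<zeta>)"
      unfolding speed_function_def laplace_transform_cdf real(2) using real(1)
      by (simp add: one_ereal_def)
    moreover have "(lam * x - lam + 1) / \<zeta> \<le> c \<longleftrightarrow> x \<le> r"
      using lam z by (simp add: r_def divide_le_eq le_divide_eq algebra_simps)
    moreover have "ennreal x \<le> ennreal r \<longleftrightarrow> x \<le> r"
      using \<open>1 \<le> x\<close> by (cases "0 \<le> r") (auto simp: ennreal_le_iff ennreal_neg)
    ultimately show ?thesis unfolding real(2) by simp
  next
    case top
    have "speed_function lam (cdf (distr P borel Z)) \<zeta> = \<infinity>"
      unfolding speed_function_def laplace_transform_cdf top using lam z
      by (simp add: one_ereal_def)
    then show ?thesis unfolding top by (simp add: top_unique)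
  qed
  ultimately show ?thesis by simp
qed

text \<open>If some exponential moment is finite, the infimum of the speed function is finite, and it is attained by compactness, so that
the \<open>LEAST\<close> in the definition of the critical speed exists.  Otherwise the speed function is identically infinite.\<close>

lemma critical_speed_cases:
  assumes lam: "0 < lam"
  obtains
    (attained) \<zeta> v where "0 < \<zeta>" "critical_speed lam (cdf (distr P borel Z)) = ereal v"
      "speed_function lam (cdf (distr P borel Z)) \<zeta> = ereal v"
      "\<And>\<xi>. 0 < \<xi> \<Longrightarrow> ereal v \<le> speed_function lam (cdf (distr P borel Z)) \<xi>"
  | (infinite) "critical_speed lam (cdf (distr P borel Z)) = \<infinity>"
      "\<And>\<xi>. 0 < \<xi> \<Longrightarrow> speed_function lam (cdf (distr P borel Z)) \<xi> = \<infinity>"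
proof -
  define J where "J = cdf (distr P borel Z)"
  define s where "s = speed_function lam J"
  note s_le_iff = speed_function_le_iff[OF lam, folded J_def, folded s_def]
  have s_pos: "0 < s \<zeta>" if z: "0 < \<zeta>" for \<zeta>
  proof (rule ccontr)
    assume "\<not> 0 < s \<zeta>"
    then have "s \<zeta> \<le> ereal 0" by (simp add: not_less zero_ereal_def)
    then have "capped_speed lam (real 0) \<zeta> \<le> 0" using s_le_iff[OF z, of 0] by blast
    moreover have "lam * 1 \<le> lam * capped_mgf 0 \<zeta>" using lam z by (intro mult_left_mono capped_mgf_ge_1) auto
    ultimately show False using z by (simp add: capped_speed_def divide_le_0_iff)
  qed
  show thesis
  proof (cases "exp_abscissa J > 0")
    case True
    then obtain \<zeta>\<^sub>0 where z0: "0 < \<zeta>\<^sub>0" "laplace_transform J (- \<zeta>\<^sub>0) < \<infinity>"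
      unfolding exp_abscissa_def less_Sup_iff by (auto simp: zero_ereal_def)
    have "s \<zeta>\<^sub>0 < \<infinity>"
      using z0 lam unfolding s_def speed_function_def
      by (cases "laplace_transform J (- \<zeta>\<^sub>0)") (auto simp: one_ereal_def)
    define m where "m = (INF \<zeta>\<in>{0<..}. s \<zeta>)"
    have "m \<le> s \<zeta>\<^sub>0" unfolding m_def using z0 by (intro INF_lower) auto
    then have "m < \<infinity>" using \<open>s \<zeta>\<^sub>0 < \<infinity>\<close> by (rule order_le_less_trans)
    moreover have "0 \<le> m" unfolding m_def using s_pos by (intro INF_greatest) (auto intro: less_imp_le)
    ultimately obtain v where v: "m = ereal v" by (cases m) auto
    have "\<exists>\<zeta>>0. capped_speed lam (real n) \<zeta> \<le> v + 1 / real (Suc n)" for n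
    proof -
      have "m < ereal (v + 1 / real (Suc n))" unfolding v by simp
      then obtain \<zeta> where "0 < \<zeta>" "s \<zeta> < ereal (v + 1 / real (Suc n))"
        unfolding m_def INF_less_iff by auto
      then show ?thesis using s_le_iff[of \<zeta> "v + 1 / real (Suc n)"] by auto
    qed
    moreover have "decseq (\<lambda>n. v + 1 / real (Suc n))"
      by (auto simp: decseq_def intro!: divide_left_mono)
    ultimately obtain \<zeta> where z: "0 < \<zeta>" "\<And>n. capped_speed lam (real n) \<zeta> \<le> v + 1 / real (Suc n)"
      using capped_speed_compactness[OF lam, of "\<lambda>n. v + 1 / real (Suc n)"] by blast
    have "capped_speed lam (real n) \<zeta> \<le> v" for n
    proof (rule field_le_epsilon)
      fix e :: real assume "0 < e"
      obtain k where k: "1 / real (Suc k) < e" using \<open>0 < e\<close> nat_approx_posE by metis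
      have "capped_speed lam (real n) \<zeta> \<le> capped_speed lam (real (max n k)) \<zeta>"
        using lam z(1) by (intro capped_speed_mono) auto
      also have "\<dots> \<le> v + 1 / real (Suc (max n k))" by (rule z(2))
      also have "\<dots> \<le> v + 1 / real (Suc k)" by (intro add_left_mono divide_left_mono) auto
      finally show "capped_speed lam (real n) \<zeta> \<le> v + e" using k by simp
    qed
    then have "s \<zeta> \<le> ereal v" using s_le_iff[OF z(1)] by blast
    moreover have lower: "ereal v \<le> s \<xi>" if "0 < \<xi>" for \<xi>
      unfolding v[symmetric] m_def using that by (intro INF_lower) auto
    ultimately have sz: "s \<zeta> = ereal v" using z(1) by (intro antisym) auto
    have "critical_speed lam J = (LEAST w. w \<in> s ` {0<..})"
      using True by (simp add: critical_speed_def s_def)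
    also have "\<dots> = ereal v"
      using sz z(1) lower by (intro Least_equality) (auto intro: image_eqI[of _ _ \<zeta>])
    finally show thesis
      using attained[of \<zeta> v] z(1) sz lower by (simp add: s_def J_def)
  next
    case False
    have "s \<xi> = \<infinity>" if xi: "0 < \<xi>" for \<xi>
    proof (rule ccontr)
      assume fin: "s \<xi> \<noteq> \<infinity>"
      have "laplace_transform J (- \<xi>) < \<infinity>"
      proof (rule ccontr)
        assume "\<not> laplace_transform J (- \<xi>) < \<infinity>"
        then have "laplace_transform J (- \<xi>) = top" by (simp add: not_less top_unique)
        then have "s \<xi> = \<infinity>" unfolding s_def speed_function_def using lam xi by (simp add: one_ereal_def)
        with fin show False by simp
      qed
      then have "ereal \<xi> \<le> exp_abscissa J"
        unfolding exp_abscissa_def using xi by (intro Sup_upper) auto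
      with False xi show False
        by (metis ereal_less(2) less_le_trans)
    qed
    then show thesis
      using infinite False by (simp add: s_def J_def critical_speed_def)
  qed
qed

end

section \<open>The speed of the quantiles\<close>

context benchmark_mfl begin

lemma quantile_init:
  assumes "0 < \<nu>" "\<nu> < 1"
  shows "quantile \<nu> (f 0) = 0"
proof -
  have "{y. \<nu> \<le> f 0 y} = {0..}" using assms by (auto simp: f_init)
  then show ?thesis by (simp add: quantile_def)
qed

lemma quantile_le:
  assumes "0 \<le> t" "0 < \<nu>" "\<nu> \<le> f t x"
  shows "quantile \<nu> (f t) \<le> x"
  unfolding quantile_def
proof (rule cInf_lower)
  note p = proper_cdfs_properties[OF f_cdf[OF assms(1)]]
  have "\<forall>\<^sub>F y in at_bot. f t y < \<nu>" using p(5) assms(2) by (rule order_tendstoD(2))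
  then obtain y where y: "f t y < \<nu>" by (auto simp: eventually_at_bot_linorder)
  have "y \<le> z" if "\<nu> \<le> f t z" for z
    using y that monoD[OF p(1), of z y] by linarith
  then show "bdd_below {y. \<nu> \<le> f t y}" by (intro bdd_belowI[of _ y]) auto
qed (use assms in auto)

lemma quantile_ge:
  assumes "0 \<le> t" "\<nu> < 1" "f t x < \<nu>"
  shows "x \<le> quantile \<nu> (f t)"
  unfolding quantile_def
proof (rule cInf_greatest)
  note p = proper_cdfs_properties[OF f_cdf[OF assms(1)]]
  have "\<forall>\<^sub>F y in at_top. \<nu> < f t y" using p(6) assms(2) by (rule order_tendstoD(1))
  then obtain y where "\<nu> < f t y" by (auto simp: eventually_at_top_linorder)
  then show "{y. \<nu> \<le> f t y} \<noteq> {}" by (auto intro: less_imp_le)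
  show "x \<le> z" if "z \<in> {y. \<nu> \<le> f t y}" for z
    using that assms(3) monoD[OF p(1), of z x] by (force simp: not_le)
qed

lemma quantile_upper:
  assumes z: "0 < \<zeta>" and v: "speed_function lam (cdf (distr P borel Z)) \<zeta> = ereal v"
    and \<nu>: "0 < \<nu>" "\<nu> < 1" and "0 \<le> t"
  shows "quantile \<nu> (f t) \<le> v * t - ln (1 - \<nu>) / \<zeta>"
proof (rule quantile_le)
  let ?X = "\<integral>\<^sup>+\<omega>. ennreal (exp (\<zeta> * Z \<omega>)) \<partial>P"
  have fin: "?X \<noteq> top"
  proof
    assume "?X = top"
    then have "speed_function lam (cdf (distr P borel Z)) \<zeta> = \<infinity>"
      unfolding speed_function_def laplace_transform_cdf using lam_pos z by (simp add: one_ereal_def)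
    with v show False by simp
  qed
  have int: "integrable P (\<lambda>\<omega>. exp (\<zeta> * Z \<omega>))"
    using fin by (intro integrableI_nonneg) (auto simp: less_top)
  then have "?X = ennreal (expectation (\<lambda>\<omega>. exp (\<zeta> * Z \<omega>)))"
    by (intro nn_integral_eq_integral) auto
  then have "(lam * expectation (\<lambda>\<omega>. exp (\<zeta> * Z \<omega>)) - lam + 1) / \<zeta> = v"
    using v unfolding speed_function_def laplace_transform_cdf
    by (simp add: one_ereal_def integral_nonneg_AE)
  then have "lam * expectation (\<lambda>\<omega>. exp (\<zeta> * Z \<omega>)) - lam + 1 = \<zeta> * v"
    using z by (auto simp: field_simps)
  from exponential_upper_barrier[OF z int this \<open>0 \<le> t\<close>, of "v * t - ln (1 - \<nu>) / \<zeta>"]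
  show "\<nu> \<le> f t (v * t - ln (1 - \<nu>) / \<zeta>)" using z \<nu> by simp
qed fact+

text \<open>The tail is at least \<open>\<delta>\<close> at the moving centre of the hump; wait for the time \<open>s\<close> at that place until \<open>f\<close> has fallen
below \<open>\<nu>\<close>.\<close>

lemma quantile_lower:
  assumes b: "0 < b" and sub: "\<And>\<zeta>. 0 < \<zeta> \<Longrightarrow> V\<^sub>1 < capped_speed lam b \<zeta>" and "V\<^sub>0 < V\<^sub>1"
    and \<nu>: "0 < \<nu>" "\<nu> < 1"
  shows "\<exists>V C T. V\<^sub>0 < V \<and> (\<forall>t\<ge>T. V * t - C \<le> quantile \<nu> (f t))"
proof -
  obtain a k \<epsilon> V where par: "0 \<le> a" "0 < k" "k * b \<le> pi" "0 < \<epsilon>" "\<epsilon> \<le> 1" "V\<^sub>0 < V"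
    "V * k = lam * expectation (\<lambda>\<omega>. exp (a * min (Z \<omega>) b) * sin (k * min (Z \<omega>) b))"
    "V * a + \<epsilon> \<le> lam * expectation (\<lambda>\<omega>. exp (a * min (Z \<omega>) b) * cos (k * min (Z \<omega>) b)) - lam + 1"
    using subcritical_hump_parameters[OF lam_pos b sub \<open>V\<^sub>0 < V\<^sub>1\<close>] by blast
  define \<delta> where "\<delta> = \<epsilon> * exp (- a * (pi / (2 * k)))"
  have "0 < \<delta>" using par(4) by (simp add: \<delta>_def)
  define s where "s = 1 / (\<delta> * (\<nu> / 2))"
  have "0 < s" using \<open>0 < \<delta>\<close> \<nu> by (simp add: s_def)
  have low: "V * (t - s) - pi / (2 * k) \<le> quantile \<nu> (f t)" if t: "s \<le> t" for t
  proof (rule quantile_ge)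
    let ?x = "V * (t - s) - pi / (2 * k)"
    have "\<delta> * hump a k (?x + pi / (2 * k) - V * (t - s)) \<le> 1 - f (t - s) ?x"
      unfolding \<delta>_def using t by (intro travelling_hump_lower_barrier[OF par(1,2) b par(3-5,7,8)]) simp
    then have "\<delta> \<le> 1 - f (t - s) ?x" by (simp add: hump_def)
    then have "f t ?x \<le> \<nu> / 2"
      using \<open>0 < \<delta>\<close> \<nu> t by (intro logistic_growth[of \<delta> "\<nu> / 2" "t - s"]) (auto simp: s_def)
    then show "f t ?x < \<nu>" using \<nu> by simp
  qed (use t \<open>0 < s\<close> \<nu> in auto)
  show ?thesis
    using par(6) low
    by (intro exI[of _ V] exI[of _ "V * s + pi / (2 * k)"] exI[of _ s]) (simp add: algebra_simps)
qed

lemma average_speed_upper: "speed_upper_bound f (critical_speed lam (cdf (distr P borel Z)))"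
  using lam_pos
proof (cases rule: critical_speed_cases)
  case (attained \<zeta> v)
  show ?thesis unfolding speed_upper_bound_def
  proof
    fix \<nu> :: real assume "\<nu> \<in> {0<..<1}"
    then have \<nu>: "0 < \<nu>" "\<nu> < 1" by auto
    define C where "C = - ln (1 - \<nu>) / \<zeta>"
    have "\<forall>\<^sub>F t in at_top. ereal (1 / t * (quantile \<nu> (f t) - quantile \<nu> (f 0))) \<le> ereal (v + C / t)"
      using eventually_gt_at_top[of 0]
    proof eventually_elim
      fix t :: real assume "0 < t"
      then show "ereal (1 / t * (quantile \<nu> (f t) - quantile \<nu> (f 0))) \<le> ereal (v + C / t)"
        using divide_right_mono[OF quantile_upper[OF attained(1,3) \<nu>, of t], of t]
        by (simp add: quantile_init[OF \<nu>] C_def diff_divide_distrib)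
    qed
    then have "Limsup at_top (\<lambda>t. ereal (1 / t * (quantile \<nu> (f t) - quantile \<nu> (f 0))))
        \<le> Limsup at_top (\<lambda>t. ereal (v + C / t))" by (rule Limsup_mono)
    also have "((\<lambda>t. v + C / t) \<longlongrightarrow> v + 0) at_top"
      by (intro tendsto_add tendsto_const tendsto_divide_0[OF tendsto_const] filterlim_at_top_imp_at_infinity filterlim_ident)
    then have "Limsup at_top (\<lambda>t. ereal (v + C / t)) = ereal v"
      by (intro lim_imp_Limsup) auto
    finally show "Limsup at_top (\<lambda>t. ereal (1 / t * (quantile \<nu> (f t) - quantile \<nu> (f 0))))
        \<le> critical_speed lam (cdf (distr P borel Z))" by (simp add: attained(2))
  qed
qed (simp add: speed_upper_bound_def)

lemma average_speed_lower: "speed_lower_bound f (critical_speed lam (cdf (distr P borel Z)))"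
  unfolding speed_lower_bound_def
proof
  fix \<nu> :: real assume "\<nu> \<in> {0<..<1}"
  then have \<nu>: "0 < \<nu>" "\<nu> < 1" by auto
  let ?crit = "critical_speed lam (cdf (distr P borel Z))"
  have crit_le: "?crit \<le> speed_function lam (cdf (distr P borel Z)) \<xi>" if "0 < \<xi>" for \<xi>
    using that by (cases rule: critical_speed_cases[OF lam_pos]) auto
  show "?crit \<le> Liminf at_top (\<lambda>t. ereal (1 / t * (quantile \<nu> (f t) - quantile \<nu> (f 0))))"
    unfolding le_Liminf_iff
  proof (intro allI impI)
    fix y assume "y < ?crit"
    then obtain V\<^sub>0 where V0: "y < ereal V\<^sub>0" "ereal V\<^sub>0 < ?crit" using ereal_dense2 by blast
    then obtain V\<^sub>1 where V1: "ereal V\<^sub>0 < ereal V\<^sub>1" "ereal V\<^sub>1 < ?crit" using ereal_dense2 by blast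
    have "\<not> (\<forall>n. \<exists>\<zeta>>0. capped_speed lam (real n) \<zeta> \<le> V\<^sub>1)"
    proof
      assume "\<forall>n. \<exists>\<zeta>>0. capped_speed lam (real n) \<zeta> \<le> V\<^sub>1"
      then obtain \<zeta> where "0 < \<zeta>" "\<And>n. capped_speed lam (real n) \<zeta> \<le> V\<^sub>1"
        using capped_speed_compactness[OF lam_pos, of "\<lambda>_. V\<^sub>1"] by (auto simp: decseq_def)
      then have "?crit \<le> ereal V\<^sub>1"
        using speed_function_le_iff[OF lam_pos, of \<zeta> V\<^sub>1] crit_le[of \<zeta>] order_trans by blast
      with V1 show False by simp
    qed
    then obtain n where n: "\<And>\<zeta>. 0 < \<zeta> \<Longrightarrow> V\<^sub>1 < capped_speed lam (real n) \<zeta>" by (meson not_le)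
    have sub: "V\<^sub>1 < capped_speed lam (real (Suc n)) \<zeta>" if "0 < \<zeta>" for \<zeta>
      using n[OF that] capped_speed_mono[OF lam_pos, of "real n" "real (Suc n)" \<zeta>] that by simp
    have "V\<^sub>0 < V\<^sub>1" using V1(1) by simp
    obtain V C T where V: "V\<^sub>0 < V" "\<And>t. T \<le> t \<Longrightarrow> V * t - C \<le> quantile \<nu> (f t)"
      using quantile_lower[OF _ sub \<open>V\<^sub>0 < V\<^sub>1\<close> \<nu>] by auto
    have "((\<lambda>t. V - C / t) \<longlongrightarrow> V - 0) at_top"
      by (intro tendsto_diff tendsto_const tendsto_divide_0[OF tendsto_const] filterlim_at_top_imp_at_infinity filterlim_ident)
    then have "\<forall>\<^sub>F t in at_top. V\<^sub>0 < V - C / t" using V(1) by (intro order_tendstoD(1)) auto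
    then show "\<forall>\<^sub>F t in at_top. y < ereal (1 / t * (quantile \<nu> (f t) - quantile \<nu> (f 0)))"
      using eventually_gt_at_top[of 0] eventually_ge_at_top[of T]
    proof eventually_elim
      fix t assume t: "V\<^sub>0 < V - C / t" "0 < t" "T \<le> t"
      have "V - C / t \<le> 1 / t * quantile \<nu> (f t)"
        using V(2)[OF t(3)] t(2) by (simp add: le_divide_eq left_diff_distrib)
      with t(1) have "ereal V\<^sub>0 < ereal (1 / t * (quantile \<nu> (f t) - quantile \<nu> (f 0)))"
        by (simp add: quantile_init[OF \<nu>])
      with V0(1) show "y < ereal (1 / t * (quantile \<nu> (f t) - quantile \<nu> (f 0)))"
        by (rule less_trans)
    qed
  qed
qed

end

theorem proposition11:
  fixes lam :: real
    and P :: "'w measure" and Z :: "'w \<Rightarrow> real" and J :: "real \<Rightarrow> real"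
    and f :: "real \<Rightarrow> real \<Rightarrow> real"
  assumes "lam > 0"
    and "prob_space P"
    and "Z \<in> borel_measurable P"
    and "AE \<omega> in P. Z \<omega> > 0"
    and "integrable P Z"
    and "prob_space.expectation P Z = 1"
    and "J = cdf (distr P borel Z)"
    and "is_bmfl lam J f"
  shows "has_average_speed f (critical_speed lam J)"
proof -
  interpret benchmark_mfl P Z lam f
    using assms
    by (intro benchmark_mfl.intro positive_jump.intro positive_jump_axioms.intro benchmark_mfl_axioms.intro) simp_all
  show ?thesis
    using average_speed_lower average_speed_upper assms(7) by (simp add: has_average_speed_def)
qed

end
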